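(* Let $D\subset\mathbb{R}^n$ be a disk. (1) There exists a constant $c_4>0$ (depending only on $D$) such that for every $f\in C^1(D,\mathbb{R})$ for which the equation $f=0$ is regular and all of its solutions belong to the interior of $D$, the total Betti number of $Z(f)$ is bounded by $$b(Z(f))\leq c_4\cdot\left(\kappa^{(1)}(f,D)\right)^{n}.$$ (2) There exists a bounded sequence $\{f_m\}_{m\in\mathbb{N}}\subset C^1(D,\mathbb{R})$ with $$\lim_{m\to\infty}\kappa^{(1)}(f_m,D)=+\infty$$ and a constant $c_5>0$ such that for every $m\in\mathbb{N}$ the zero set $Z(f_m)\subset\mathrm{int}(D)$ is regular and $$b(Z(f_m))\geq c_5\cdot\left(\kappa^{(1)}(f_m,D)\right)^{n}.$$
   Context: A disk is a closed Euclidean ball of positive radius. $Z(f)=\{z\in D:f(z)=0\}$, and $b(X)$ is the sum of the Betti numbers of $X$. The equation $f=0$ (or its zero set) is regular if $\nabla f(z)\neq0$ at every $z\in Z(f)$ (and the same holds for $f|_{\partial D}$, vacuously when $Z(f)\subset\mathrm{int}(D)$). Boundedness of the sequence is with respect to the norm $$\|f\|_{C^1(D,\mathbb{R})}=\sup_{z\in D}\left(|f(z)|^2+|\nabla f(z)|^2\right)^{1/2}.$$ Moreover $$\delta(f,D)=\min\left\{\inf_{z\in D}\left(|f(z)|^2+|\nabla f(z)|^2\right)^{1/2},\ \inf_{z\in\partial D}\left(|f(z)|^2+|\nabla(f|_{\partial D})(z)|^2\right)^{1/2}\right\},\qquad \kappa^{(1)}(f,D)=\frac{\|f\|_{C^1(D,\mathbb{R})}}{\delta(f,D)}.$$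 *)

theory Defs
  imports "HOL-Analysis.Analysis" "HOL-Homology.Homology"
begin

section \<open>Continuously differentiable functions on a disk\<close>

text \<open>The disk with centre \<open>c\<close> and radius \<open>r > 0\<close> is \<open>D = cball c r\<close>, with boundary
  \<open>sphere c r\<close>. All derivatives below are taken within \<open>D\<close> or within its boundary, so they
  depend only on the values of \<open>f\<close> there.\<close>

definition disk_gradient :: "real^'n \<Rightarrow> real \<Rightarrow> (real^'n \<Rightarrow> real) \<Rightarrow> real^'n \<Rightarrow> real^'n" where
  "disk_gradient c r f z = (THE g. (f has_derivative (\<lambda>h. g \<bullet> h)) (at z within cball c r))"

text \<open>The gradient at \<open>z\<close> of the restriction of \<open>f\<close> to the sphere is the vector tangent to the
  sphere that represents the derivative of the restriction. Derivatives within the sphere are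
  determined only on tangent vectors, so the tangency condition is what makes it unique.\<close>

definition sphere_gradient :: "real^'n \<Rightarrow> real \<Rightarrow> (real^'n \<Rightarrow> real) \<Rightarrow> real^'n \<Rightarrow> real^'n" where
  "sphere_gradient c r f z =
     (THE g. g \<bullet> (z - c) = 0 \<and> (f has_derivative (\<lambda>h. g \<bullet> h)) (at z within sphere c r))"

definition C1_on_disk :: "real^'n \<Rightarrow> real \<Rightarrow> (real^'n \<Rightarrow> real) \<Rightarrow> bool" where
  "C1_on_disk c r f \<longleftrightarrow>
     f differentiable_on cball c r \<and> continuous_on (cball c r) (disk_gradient c r f)"

definition C1_norm :: "real^'n \<Rightarrow> real \<Rightarrow> (real^'n \<Rightarrow> real) \<Rightarrow> real" where
  "C1_norm c r f = (SUP z\<in>cball c r. sqrt ((f z)\<^sup>2 + (norm (disk_gradient c r f z))\<^sup>2))"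

definition zero_set :: "real^'n \<Rightarrow> real \<Rightarrow> (real^'n \<Rightarrow> real) \<Rightarrow> (real^'n) set" where
  "zero_set c r f = {z \<in> cball c r. f z = 0}"

definition regular :: "real^'n \<Rightarrow> real \<Rightarrow> (real^'n \<Rightarrow> real) \<Rightarrow> bool" where
  "regular c r f \<longleftrightarrow>
     (\<forall>z\<in>zero_set c r f. disk_gradient c r f z \<noteq> 0) \<and>
     (\<forall>z\<in>zero_set c r f \<inter> sphere c r. sphere_gradient c r f z \<noteq> 0)"

definition delta :: "real^'n \<Rightarrow> real \<Rightarrow> (real^'n \<Rightarrow> real) \<Rightarrow> real" where
  "delta c r f =
     min (INF z\<in>cball c r. sqrt ((f z)\<^sup>2 + (norm (disk_gradient c r f z))\<^sup>2))
         (INF z\<in>sphere c r. sqrt ((f z)\<^sup>2 + (norm (sphere_gradient c r f z))\<^sup>2))"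

text \<open>For a regular \<open>C\<^sup>1\<close> function \<open>delta\<close> is positive, by compactness, so the quotient
  is then a genuine one.\<close>

definition kappa1 :: "real^'n \<Rightarrow> real \<Rightarrow> (real^'n \<Rightarrow> real) \<Rightarrow> real" where
  "kappa1 c r f = C1_norm c r f / delta c r f"


section \<open>Betti numbers\<close>

definition independent_in :: "('a, 'b) monoid_scheme \<Rightarrow> 'a set \<Rightarrow> bool" where
  "independent_in G B \<longleftrightarrow> finite B \<and> B \<subseteq> carrier G \<and>
     (\<forall>k :: 'a \<Rightarrow> int. finprod G (\<lambda>x. x [^]\<^bsub>G\<^esub> k x) B = \<one>\<^bsub>G\<^esub> \<longrightarrow> (\<forall>x\<in>B. k x = 0))"

definition abelian_rank :: "('a, 'b) monoid_scheme \<Rightarrow> enat" where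
  "abelian_rank G = (SUP B\<in>{B. independent_in G B}. enat (card B))"

text \<open>Integral singular homology. The values are extended naturals because ranks, and their sum,
  need not be finite for an arbitrary space.\<close>

definition betti :: "nat \<Rightarrow> 'a topology \<Rightarrow> enat" where
  "betti p X = abelian_rank (homology_group (int p) X)"

definition total_betti :: "'a::topological_space set \<Rightarrow> enat" where
  "total_betti S = (\<Sum>\<^sub>\<infinity>p. betti p (top_of_set S))"


section \<open>The gradients are well defined\<close>

lemma derivative_along_curve:
  fixes d z :: "real^'n" and \<gamma> :: "real \<Rightarrow> real^'n"
  assumes f: "(f has_derivative (\<lambda>h. a \<bullet> h)) (at z within S)"
    and f': "(f has_derivative (\<lambda>h. b \<bullet> h)) (at z within S)"
    and \<gamma>: "(\<gamma> has_vector_derivative u) (at 0 within {0..1})"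
    and "\<gamma> 0 = z" and S: "\<gamma> ` {0..1} \<subseteq> S"
  shows "a \<bullet> u = b \<bullet> u"
proof -
  have *: "((f \<circ> \<gamma>) has_vector_derivative e \<bullet> u) (at 0 within cbox 0 1)"
    if "(f has_derivative (\<lambda>h. e \<bullet> h)) (at z within S)" for e
  proof -
    have "(f has_derivative (\<lambda>h. e \<bullet> h)) (at (\<gamma> 0) within \<gamma> ` {0..1})"
      using has_derivative_subset[OF that S] \<open>\<gamma> 0 = z\<close> by simp
    from diff_chain_within[OF \<gamma>[unfolded has_vector_derivative_def] this] show ?thesis
      by (simp add: has_vector_derivative_def o_def)
  qed
  show ?thesis
    using vector_derivative_unique_within_closed_interval[OF _ _ *[OF f] *[OF f']] by simp
qed

lemma disk_gradient_unique:
  fixes z :: "real^'n"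
  assumes "r > 0" and z: "z \<in> cball c r"
    and a: "(f has_derivative (\<lambda>h. a \<bullet> h)) (at z within cball c r)"
    and b: "(f has_derivative (\<lambda>h. b \<bullet> h)) (at z within cball c r)"
  shows "a = b"
proof -
  have *: "a \<bullet> (w - z) = b \<bullet> (w - z)" if "w \<in> cball c r" for w
  proof (rule derivative_along_curve[OF a b])
    show "((\<lambda>t. z + t *\<^sub>R (w - z)) has_vector_derivative w - z) (at 0 within {0..1})"
      by (auto intro!: derivative_eq_intros)
    have "z + t *\<^sub>R (w - z) \<in> cball c r" if "t \<in> {0..1}" for t
      using convexD_alt[OF convex_cball z \<open>w \<in> cball c r\<close>, of t] that
      by (simp add: algebra_simps)
    then show "(\<lambda>t. z + t *\<^sub>R (w - z)) ` {0..1} \<subseteq> cball c r" by blast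
  qed simp
  have pos: "1 + norm (a - b) > 0" by (simp add: add_pos_nonneg)
  define w where "w = c + (r / (1 + norm (a - b))) *\<^sub>R (a - b)"
  have "w \<in> cball c r"
    using \<open>r > 0\<close> pos by (simp add: w_def dist_norm pos_divide_le_eq mult_left_mono)
  then have "(a - b) \<bullet> (w - c) = 0"
    using *[of w] *[of c] \<open>r > 0\<close> by (simp add: algebra_simps)
  moreover have "(a - b) \<bullet> (w - c) = r / (1 + norm (a - b)) * ((a - b) \<bullet> (a - b))"
    by (simp add: w_def)
  ultimately have "(a - b) \<bullet> (a - b) = 0"
    using \<open>r > 0\<close> pos by (metis divide_eq_0_iff less_irrefl mult_eq_0_iff)
  then show ?thesis by simp
qed

lemma disk_gradient_eqI:
  fixes z :: "real^'n"
  assumes "r > 0" "z \<in> cball c r" "(f has_derivative (\<lambda>h. g \<bullet> h)) (at z within cball c r)"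
  shows "disk_gradient c r f z = g"
  unfolding disk_gradient_def using assms disk_gradient_unique by blast

lemma has_derivative_disk_gradient:
  fixes z :: "real^'n"
  assumes "r > 0" "z \<in> cball c r" and "f differentiable (at z within cball c r)"
  shows "(f has_derivative (\<lambda>h. disk_gradient c r f z \<bullet> h)) (at z within cball c r)"
proof -
  obtain f' where f': "(f has_derivative f') (at z within cball c r)"
    using assms(3) by (auto simp: differentiable_def)
  then interpret bounded_linear f' by (rule has_derivative_bounded_linear)
  have "f' = (\<lambda>h. adjoint f' 1 \<bullet> h)"
    using adjoint_clauses(2)[OF linear_axioms] by fastforce
  then show ?thesis using f' disk_gradient_eqI[OF assms(1,2)] by metis
qed

lemma sphere_gradient_unique:
  fixes z :: "real^'n"
  assumes "r > 0" and z: "z \<in> sphere c r"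
    and a: "(f has_derivative (\<lambda>h. a \<bullet> h)) (at z within sphere c r)" "a \<bullet> (z - c) = 0"
    and b: "(f has_derivative (\<lambda>h. b \<bullet> h)) (at z within sphere c r)" "b \<bullet> (z - c) = 0"
  shows "a = b"
proof (rule ccontr)
  assume "a \<noteq> b"
  define u where "u = (r / norm (a - b)) *\<^sub>R (a - b)"
  define \<gamma> where "\<gamma> t = c + cos t *\<^sub>R (z - c) + sin t *\<^sub>R u" for t
  have nz: "norm (z - c) = r" using z by (simp add: dist_norm norm_minus_commute)
  have nu: "norm u = r" using \<open>a \<noteq> b\<close> \<open>r > 0\<close> by (simp add: u_def)
  have "(a - b) \<bullet> (z - c) = 0"
    using a(2) b(2) by (simp only: inner_diff_left)
  then have orth: "(z - c) \<bullet> u = 0"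
    by (simp only: u_def inner_scaleR_right inner_commute[of "z - c"] mult_zero_right)
  have "a \<bullet> u = b \<bullet> u"
  proof (rule derivative_along_curve[OF a(1) b(1)])
    have "(\<gamma> has_vector_derivative 0 + (cos 0 *\<^sub>R 0 + (- sin 0) *\<^sub>R (z - c))
        + (sin 0 *\<^sub>R 0 + cos 0 *\<^sub>R u)) (at 0 within {0..1})"
      unfolding \<gamma>_def
      by (intro has_vector_derivative_add has_vector_derivative_const has_vector_derivative_scaleR
          DERIV_subset[OF DERIV_cos] DERIV_subset[OF DERIV_sin] subset_UNIV)
    then show "(\<gamma> has_vector_derivative u) (at 0 within {0..1})" by simp
    have "(norm (\<gamma> t - c))\<^sup>2 = r\<^sup>2" for t
    proof -
      have "(norm (\<gamma> t - c))\<^sup>2 = (cos t)\<^sup>2 * (norm (z - c))\<^sup>2 + (sin t)\<^sup>2 * (norm u)\<^sup>2"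
        using orth unfolding \<gamma>_def power2_norm_eq_inner
        by (simp add: inner_add_left inner_add_right inner_commute[of u "z - c"] power2_eq_square)
      then show ?thesis by (simp add: nz nu flip: distrib_right)
    qed
    then have "norm (\<gamma> t - c) = r" for t
      using \<open>r > 0\<close> power2_eq_imp_eq[of "norm (\<gamma> t - c)" r] by simp
    then show "\<gamma> ` {0..1} \<subseteq> sphere c r" by (auto simp: dist_norm norm_minus_commute)
  qed (simp add: \<gamma>_def)
  then have "(a - b) \<bullet> u = 0" by (simp add: inner_diff_left)
  then have "r * norm (a - b) = 0"
    using \<open>a \<noteq> b\<close> by (simp add: u_def)
  then show False using \<open>a \<noteq> b\<close> \<open>r > 0\<close> by simp
qed

lemma sphere_gradient_eq_projection:
  fixes z :: "real^'n"
  assumes "r > 0" and z: "z \<in> sphere c r" and f: "f differentiable (at z within cball c r)"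
  defines "g \<equiv> disk_gradient c r f z"
  shows "sphere_gradient c r f z = g - (g \<bullet> (z - c) / r\<^sup>2) *\<^sub>R (z - c)" (is "_ = ?v")
    and "(f has_derivative (\<lambda>h. sphere_gradient c r f z \<bullet> h)) (at z within sphere c r)"
proof -
  have nz: "(z - c) \<bullet> (z - c) = r\<^sup>2"
    using z by (simp add: dist_norm norm_minus_commute flip: power2_norm_eq_inner)
  have "(f has_derivative (\<lambda>h. g \<bullet> h)) (at z within cball c r)"
    unfolding g_def using assms sphere_cball by (intro has_derivative_disk_gradient) blast+
  then have df: "(f has_derivative (\<lambda>h. g \<bullet> h)) (at z within sphere c r)"
    by (rule has_derivative_subset) (rule sphere_cball)
  have "((\<lambda>w. ((w - c) \<bullet> (w - c) - r\<^sup>2) / 2) has_derivative (\<lambda>h. (z - c) \<bullet> h)) (at z within sphere c r)"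
    by (auto intro!: derivative_eq_intros simp: inner_commute)
  then have "((\<lambda>_. 0) has_derivative (\<lambda>h. (z - c) \<bullet> h)) (at z within sphere c r)"
    by (rule has_derivative_transform[OF z, rotated])
       (auto simp: dist_norm norm_minus_commute simp flip: power2_norm_eq_inner)
  from has_derivative_diff[OF df has_derivative_mult_right[OF this, of "g \<bullet> (z - c) / r\<^sup>2"]]
  have v: "(f has_derivative (\<lambda>h. ?v \<bullet> h)) (at z within sphere c r)"
    by (simp add: inner_diff_left)
  have v0: "?v \<bullet> (z - c) = 0"
    using nz \<open>r > 0\<close> by (simp add: inner_diff_left)
  show eq: "sphere_gradient c r f z = ?v"
    unfolding sphere_gradient_def
    using v v0 sphere_gradient_unique[OF \<open>r > 0\<close> z] by (intro the_equality) blast+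
  show "(f has_derivative (\<lambda>h. sphere_gradient c r f z \<bullet> h)) (at z within sphere c r)"
    using v by (simp add: eq)
qed

end

theory Submission
  imports Defs
begin

text \<open>For the upper bound, \<open>|f| \<ge> \<delta>\<close> on the boundary sphere, because the tangential gradient vanishes
  where \<open>|f|\<close> is smallest there, and the gradient of \<open>f\<close> has no zero on the band \<open>|f| \<le> \<delta>/2\<close>.
  Gradient steps therefore retract the band onto \<open>Z(f)\<close>. Cover \<open>Z(f)\<close> by the open cubes of a grid
  of mesh proportional to \<open>1/\<kappa>\<close> that meet it. By the Lipschitz bound their union \<open>K\<close> lies in the
  band, so \<open>Z(f)\<close> is a retract of \<open>K\<close> and has at most the Betti numbers of \<open>K\<close>. Exactness and
  excision bound these by the number of subfamilies of cubes with a common point, which is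
  \<open>O(\<kappa>\<^sup>n)\<close>.

  For the lower bound, place about \<open>m\<^sup>n\<close> disjoint bumps of width and height about \<open>1/m\<close> in \<open>D\<close>
  and subtract half their height: the zero set has one piece in each bump, while \<open>\<kappa> = O(m)\<close>.\<close>

section \<open>Ranks of abelian groups\<close>

text \<open>The gradient of \<open>f\<close> is merely continuous, so a gradient flow need not be
  unique; this is why the retraction is the limit of a discrete iteration. A bare retraction
  suffices: it embeds the homology of \<open>Z(f)\<close> in that of \<open>K\<close>, without any
  homotopy. The scale \<open>1/\<kappa>\<close> is forced: \<open>f\<close> is Lipschitz with
  constant \<open>C1_norm\<close>, so within distance \<open>1/(2\<kappa>)\<close> of a zero
  \<open>|f|\<close> stays at most \<open>delta/2\<close>. The cubes have side twice the spacing of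
  their centres: they overlap and cover, yet each meets at most \<open>3 ^ n\<close> of them, so the
  number of subfamilies with a common point is at most the number of cubes times a factor depending
  on \<open>n\<close> alone. Ranks of integral homology are compared by subadditivity along exact
  sequences, with values in \<open>enat\<close>, so that no Betti number has to be known finite
  beforehand. In the example the height must shrink like the width, which keeps the gradients
  bounded. At the tops of the bumps and outside them the gradient vanishes and only
  \<open>|f| = mesh / 2\<close> keeps \<open>delta\<close> away from zero, so \<open>delta\<close>
  is of order \<open>1/m\<close>.\<close>

definition independent_family :: "('a, 'b) monoid_scheme \<Rightarrow> ('i \<Rightarrow> 'a) \<Rightarrow> 'i set \<Rightarrow> bool" where
  "independent_family G x I \<longleftrightarrow> finite I \<and> x ` I \<subseteq> carrier G \<and>
     (\<forall>k :: 'i \<Rightarrow> int. finprod G (\<lambda>i. x i [^]\<^bsub>G\<^esub> k i) I = \<one>\<^bsub>G\<^esub> \<longrightarrow> (\<forall>i\<in>I. k i = 0))"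

lemma independent_familyD:
  "independent_family G x I \<Longrightarrow> finprod G (\<lambda>i. x i [^]\<^bsub>G\<^esub> k i) I = \<one>\<^bsub>G\<^esub> \<Longrightarrow> i \<in> I \<Longrightarrow> k i = (0::int)"
  unfolding independent_family_def by blast

lemma independent_in_iff_family: "independent_in G B \<longleftrightarrow> independent_family G (\<lambda>x. x) B"
  by (simp add: independent_in_def independent_family_def)

text \<open>Indexed families can be pushed through homomorphisms without first checking that the
  images are distinct. Independence itself makes the family injective: equal entries at
  \<open>i\<close> and \<open>j\<close> would satisfy the relation with coefficients 1 and
  -1.\<close>

lemma card_le_abelian_rank:
  assumes "comm_group G" "independent_family G x I"
  shows "enat (card I) \<le> abelian_rank G"
proof -
  interpret comm_group G by fact
  have fin: "finite I" and car: "\<And>i. i \<in> I \<Longrightarrow> x i \<in> carrier G"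
    using assms(2) by (auto simp: independent_family_def)
  have inj: "inj_on x I"
  proof (rule inj_onI, rule ccontr)
    fix i j assume ij: "i \<in> I" "j \<in> I" "x i = x j" "i \<noteq> j"
    define k where "k l = (if l = i then 1 else if l = j then -1 else (0::int))" for l
    have "finprod G (\<lambda>l. x l [^]\<^bsub>G\<^esub> k l) I = finprod G (\<lambda>l. x l [^]\<^bsub>G\<^esub> k l) {i, j}"
      by (rule finprod_mono_neutral_cong_right) (use fin ij car in \<open>auto simp: k_def\<close>)
    also have "\<dots> = \<one>\<^bsub>G\<^esub>"
      using ij car by (simp add: k_def int_pow_neg Pi_def)
    finally show False
      using independent_familyD[OF assms(2) _ \<open>i \<in> I\<close>, of k] by (simp add: k_def)
  qed
  have "independent_in G (x ` I)"
    unfolding independent_in_def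
  proof (intro conjI allI impI)
    fix k :: "'a \<Rightarrow> int" assume "(\<Otimes>\<^bsub>G\<^esub>y\<in>x ` I. y [^]\<^bsub>G\<^esub> k y) = \<one>\<^bsub>G\<^esub>"
    then have "(\<Otimes>\<^bsub>G\<^esub>i\<in>I. x i [^]\<^bsub>G\<^esub> k (x i)) = \<one>\<^bsub>G\<^esub>"
      by (subst (asm) finprod_reindex) (use inj car in \<open>auto simp: Pi_iff\<close>)
    from independent_familyD[OF assms(2), of "\<lambda>i. k (x i)", OF this]
    show "\<forall>y\<in>x ` I. k y = 0" by blast
  qed (use fin car in auto)
  then have "enat (card (x ` I)) \<le> abelian_rank G"
    unfolding abelian_rank_def by (intro SUP_upper) simp
  then show ?thesis using card_image[OF inj] by simp
qed

lemma abelian_rank_leI: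
  "(\<And>B. independent_in G B \<Longrightarrow> enat (card B) \<le> n) \<Longrightarrow> abelian_rank G \<le> n"
  unfolding abelian_rank_def by (intro SUP_least) auto

section \<open>Finite products in abelian groups and subadditivity of the rank\<close>

lemma (in group_hom) hom_finprod_group:
  assumes "comm_group G" "comm_group H" "finite I" "x \<in> I \<rightarrow> carrier G"
  shows "h (finprod G x I) = finprod H (\<lambda>i. h (x i)) I"
  using assms(3,4)
proof (induction I rule: finite_induct)
  case empty then show ?case
    using assms(1,2) by (simp add: comm_group_def comm_monoid.finprod_empty)
next
  case (insert a I)
  have 1: "comm_monoid G" "comm_monoid H" using assms(1,2) by (auto simp: comm_group_def)
  have "x \<in> I \<rightarrow> carrier G" "x a \<in> carrier G" using insert.prems by auto
  moreover have "(\<lambda>i. h (x i)) \<in> I \<rightarrow> carrier H" "h (x a) \<in> carrier H"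
    using insert.prems by (auto simp: Pi_iff intro!: hom_closed)
  ultimately have "h (finprod G x (insert a I)) = h (x a) \<otimes>\<^bsub>H\<^esub> h (finprod G x I)"
    "finprod H (\<lambda>i. h (x i)) (insert a I) = h (x a) \<otimes>\<^bsub>H\<^esub> finprod H (\<lambda>i. h (x i)) I"
    "h (finprod G x I) = finprod H (\<lambda>i. h (x i)) I"
    using comm_monoid.finprod_insert[OF 1(1) insert(1,2)]
      comm_monoid.finprod_insert[OF 1(2) insert(1,2)] comm_monoid.finprod_closed[OF 1(1), of x I]
      hom_mult insert.IH by auto
  then show ?case by simp
qed

lemma (in comm_group) finprod_int_pow:
  assumes "finite I" "x \<in> I \<rightarrow> carrier G"
  shows "finprod G x I [^] (m::int) = finprod G (\<lambda>i. x i [^] m) I"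
  using assms
proof (induction I rule: finite_induct)
  case (insert a I)
  then have "x \<in> I \<rightarrow> carrier G" "x a \<in> carrier G" by auto
  with insert show ?case by (simp add: int_pow_distrib Pi_def)
qed simp

lemma (in comm_group) finprod_int_pow_sum:
  assumes "finite I" "y \<in> carrier G"
  shows "finprod G (\<lambda>i. y [^] (m i :: int)) I = y [^] (\<Sum>i\<in>I. m i)"
  using assms(1)
  by (induction I rule: finite_induct) (use assms(2) in \<open>simp_all add: int_pow_mult\<close>)

lemma (in comm_group) finprod_swap:
  assumes "finite I" "finite J" "\<And>i j. i \<in> I \<Longrightarrow> j \<in> J \<Longrightarrow> x i j \<in> carrier G"
  shows "finprod G (\<lambda>i. finprod G (x i) J) I = finprod G (\<lambda>j. finprod G (\<lambda>i. x i j) I) J"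
  using assms(1,3)
proof (induction I rule: finite_induct)
  case (insert a I)
  then have *: "x a \<in> J \<rightarrow> carrier G" "(\<lambda>i. finprod G (x i) J) \<in> I \<rightarrow> carrier G"
    "(\<lambda>j. finprod G (\<lambda>i. x i j) I) \<in> J \<rightarrow> carrier G"
    by (auto intro!: finprod_closed)
  have "finprod G (\<lambda>i. finprod G (x i) J) (insert a I)
      = finprod G (x a) J \<otimes> finprod G (\<lambda>j. finprod G (\<lambda>i. x i j) I) J"
    using insert * by (subst finprod_insert) (auto intro!: finprod_closed)
  also have "\<dots> = finprod G (\<lambda>j. x a j \<otimes> finprod G (\<lambda>i. x i j) I) J"
    using * by (subst finprod_multf) auto
  also have "\<dots> = finprod G (\<lambda>j. finprod G (\<lambda>i. x i j) (insert a I)) J"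
    using insert by (intro finprod_cong') (auto intro!: finprod_closed)
  finally show ?case .
qed simp

text \<open>A maximal part \<open>S\<close> of an independent set \<open>B\<close> with independent image in \<open>C\<close> leaves, for
  each \<open>x \<in> B - S\<close>, a combination of \<open>x\<close> and \<open>S\<close> that comes from \<open>A\<close>.\<close>

lemma abelian_rank_exact:
  assumes gr: "comm_group A" "comm_group G" "comm_group C"
    and g: "g \<in> hom A G" and h: "h \<in> hom G C"
    and ex: "kernel G C h \<subseteq> g ` carrier A"
  shows "abelian_rank G \<le> abelian_rank A + abelian_rank C"
proof (rule abelian_rank_leI)
  fix B assume "independent_in G B"
  then have B: "independent_family G (\<lambda>x. x) B" by (simp add: independent_in_iff_family)
  then have fin: "finite B" and BG: "B \<subseteq> carrier G" by (auto simp: independent_family_def)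
  interpret A: comm_group A by fact
  interpret G: comm_group G by fact
  interpret C: comm_group C by fact
  interpret g: group_hom A G g
    using g by (simp add: A.group_axioms G.group_axioms group_hom_def group_hom_axioms_def)
  interpret h: group_hom G C h
    using h by (simp add: C.group_axioms G.group_axioms group_hom_def group_hom_axioms_def)
  let ?P = "\<lambda>S. S \<subseteq> B \<and> independent_family C h S"
  have "?P {}" by (simp add: independent_family_def)
  moreover have "\<forall>S. ?P S \<longrightarrow> card S < Suc (card B)"
    using card_mono[OF fin] by (simp add: less_Suc_eq_le)
  ultimately obtain S where S: "?P S" and max: "\<And>T. ?P T \<Longrightarrow> card T \<le> card S"
    using ex_has_greatest_nat[of ?P "{}" card "Suc (card B)"] by blast
  have finS: "finite S" using S by (simp add: independent_family_def)
  have hS: "h ` S \<subseteq> carrier C" using S by (simp add: independent_family_def)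
  define Q where "Q x k a \<longleftrightarrow> (\<forall>b. b \<notin> insert x S \<longrightarrow> k b = (0::int)) \<and> k x \<noteq> 0 \<and> a \<in> carrier A \<and>
      g a = finprod G (\<lambda>b. b [^]\<^bsub>G\<^esub> k b) B" for x k a
  \<comment> \<open>By maximality the images of \<open>insert x S\<close> satisfy a nontrivial
    relation, and the independence over \<open>S\<close> forces the coefficient of \<open>x\<close>
    to be nonzero. Extended by zero to \<open>B\<close>, the relation defines an element of the
    kernel of \<open>h\<close>.\<close>
  have "\<exists>k a. Q x k a" if x: "x \<in> B - S" for x
  proof -
    have "\<not> ?P (insert x S)"
      using max[of "insert x S"] x finS by auto
    then obtain k :: "_ \<Rightarrow> int" where k: "finprod C (\<lambda>b. h b [^]\<^bsub>C\<^esub> k b) (insert x S) = \<one>\<^bsub>C\<^esub>"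
      and knz: "\<exists>b\<in>insert x S. k b \<noteq> 0"
      using x S BG finS by (auto simp: independent_family_def)
    have pc: "(\<lambda>b. h b [^]\<^bsub>C\<^esub> k b) \<in> S \<rightarrow> carrier C" "h x [^]\<^bsub>C\<^esub> k x \<in> carrier C"
      using hS x BG by auto
    have "k x \<noteq> 0"
    proof
      assume "k x = 0"
      then have "finprod C (\<lambda>b. h b [^]\<^bsub>C\<^esub> k b) S = \<one>\<^bsub>C\<^esub>"
        using k x finS pc by (simp add: C.finprod_closed)
      then have "\<forall>b\<in>S. k b = 0" using S unfolding independent_family_def by blast
      then show False using knz \<open>k x = 0\<close> by auto
    qed
    define k' where "k' b = (if b \<in> insert x S then k b else 0)" for b
    have B2: "insert x S \<subseteq> B" using x S by auto
    have Bc: "(\<lambda>b. b [^]\<^bsub>G\<^esub> k' b) \<in> B \<rightarrow> carrier G" using BG by auto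
    have "h (finprod G (\<lambda>b. b [^]\<^bsub>G\<^esub> k' b) B) = finprod C (\<lambda>b. h (b [^]\<^bsub>G\<^esub> k' b)) B"
      by (rule h.hom_finprod_group[OF gr(2,3) fin Bc])
    also have "\<dots> = finprod C (\<lambda>b. h b [^]\<^bsub>C\<^esub> k' b) B"
      using BG by (intro C.finprod_cong') (auto simp: h.hom_int_pow)
    also have "\<dots> = finprod C (\<lambda>b. h b [^]\<^bsub>C\<^esub> k b) (insert x S)"
      using BG B2 fin by (intro C.finprod_mono_neutral_cong_right) (auto simp: k'_def)
    finally have "finprod G (\<lambda>b. b [^]\<^bsub>G\<^esub> k' b) B \<in> kernel G C h"
      using k Bc by (simp add: kernel_def)
    then have "finprod G (\<lambda>b. b [^]\<^bsub>G\<^esub> k' b) B \<in> g ` carrier A" using ex by (rule subsetD[rotated])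
    then obtain a where "a \<in> carrier A" "g a = finprod G (\<lambda>b. b [^]\<^bsub>G\<^esub> k' b) B"
      by (metis imageE)
    moreover have "k' x \<noteq> 0" "\<forall>b. b \<notin> insert x S \<longrightarrow> k' b = 0"
      using \<open>k x \<noteq> 0\<close> by (auto simp: k'_def)
    ultimately show ?thesis unfolding Q_def by blast
  qed
  then obtain k where "\<forall>x\<in>B - S. \<exists>a. Q x (k x) a"
    using bchoice[of "B - S" "\<lambda>x k. \<exists>a. Q x k a"] by blast
  then obtain a where "\<forall>x\<in>B - S. Q x (k x) (a x)"
    using bchoice[of "B - S" "\<lambda>x a. Q x (k x) a"] by blast
  then have k0: "\<And>x b. x \<in> B - S \<Longrightarrow> b \<notin> insert x S \<Longrightarrow> k x b = (0::int)"
    and kx: "\<And>x. x \<in> B - S \<Longrightarrow> k x x \<noteq> 0"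
    and a: "\<And>x. x \<in> B - S \<Longrightarrow> a x \<in> carrier A"
    and ga: "\<And>x. x \<in> B - S \<Longrightarrow> g (a x) = finprod G (\<lambda>b. b [^]\<^bsub>G\<^esub> k x b) B"
    unfolding Q_def by auto
  have "independent_family A a (B - S)"
    unfolding independent_family_def
  proof (intro conjI allI impI)
    fix m :: "_ \<Rightarrow> int" assume m: "finprod A (\<lambda>x. a x [^]\<^bsub>A\<^esub> m x) (B - S) = \<one>\<^bsub>A\<^esub>"
    have "\<one>\<^bsub>G\<^esub> = g (finprod A (\<lambda>x. a x [^]\<^bsub>A\<^esub> m x) (B - S))" by (simp add: m)
    also have "\<dots> = finprod G (\<lambda>x. g (a x [^]\<^bsub>A\<^esub> m x)) (B - S)"
      by (rule g.hom_finprod_group[OF gr(1,2)]) (use fin a in auto)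
    also have "\<dots> = finprod G (\<lambda>x. finprod G (\<lambda>b. b [^]\<^bsub>G\<^esub> (k x b * m x)) B) (B - S)"
    proof (rule G.finprod_cong')
      fix x assume x: "x \<in> B - S"
      have "g (a x [^]\<^bsub>A\<^esub> m x) = finprod G (\<lambda>b. b [^]\<^bsub>G\<^esub> k x b) B [^]\<^bsub>G\<^esub> m x"
        using a[OF x] ga[OF x] by (simp add: g.hom_int_pow)
      also have "\<dots> = finprod G (\<lambda>b. (b [^]\<^bsub>G\<^esub> k x b) [^]\<^bsub>G\<^esub> m x) B"
        by (rule G.finprod_int_pow[OF fin]) (use BG in auto)
      also have "\<dots> = finprod G (\<lambda>b. b [^]\<^bsub>G\<^esub> (k x b * m x)) B"
        using BG by (intro G.finprod_cong') (auto simp: G.int_pow_pow)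
      finally show "g (a x [^]\<^bsub>A\<^esub> m x) = \<dots>" .
    qed (use BG in \<open>auto intro!: G.finprod_closed\<close>)
    also have "\<dots> = finprod G (\<lambda>b. finprod G (\<lambda>x. b [^]\<^bsub>G\<^esub> (k x b * m x)) (B - S)) B"
      using fin BG by (intro G.finprod_swap) auto
    also have "\<dots> = finprod G (\<lambda>b. b [^]\<^bsub>G\<^esub> (\<Sum>x\<in>B - S. k x b * m x)) B"
      using fin BG by (intro G.finprod_cong') (auto simp: G.finprod_int_pow_sum)
    finally have z: "(\<Sum>x\<in>B - S. k x b * m x) = 0" if "b \<in> B" for b
      using independent_familyD[OF B _ that, of "\<lambda>b. \<Sum>x\<in>B - S. k x b * m x"] by simp
    \<comment> \<open>Restricted to \<open>B - S\<close>, the matrix \<open>k\<close> is diagonal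
      with nonzero diagonal, since \<open>k x\<close> vanishes outside \<open>insert x S\<close>.
      Each sum in \<open>z\<close> thus reduces to one term.\<close>
    show "\<forall>x\<in>B - S. m x = 0"
    proof
      fix y assume y: "y \<in> B - S"
      have "(\<Sum>x\<in>B - S. k x y * m x) = (\<Sum>x\<in>{y}. k x y * m x)"
        using y fin k0 by (intro sum.mono_neutral_right) auto
      then show "m y = 0" using z[of y] kx[OF y] y by simp
    qed
  qed (use fin a in auto)
  then have "enat (card (B - S)) \<le> abelian_rank A" by (rule card_le_abelian_rank[OF gr(1)])
  moreover have "enat (card S) \<le> abelian_rank C"
    using S by (intro card_le_abelian_rank[OF gr(3)]) auto
  moreover have "card B = card (B - S) + card S"
    using card_Diff_subset[OF finS, of B] card_mono[OF fin, of S] S by simp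
  ultimately show "enat (card B) \<le> abelian_rank A + abelian_rank C"
    by (metis add_mono plus_enat_simps(1))
qed

lemma abelian_rank_trivial_group:
  assumes "trivial_group G"
  shows "abelian_rank G = 0"
proof -
  have G: "group G" and c: "carrier G = {\<one>\<^bsub>G\<^esub>}" using assms by (auto simp: trivial_group_def)
  interpret comm_group G by (rule group.group_comm_groupI[OF G]) (use c in auto)
  have "B = {}" if B: "independent_in G B" for B
  proof (rule ccontr)
    assume "B \<noteq> {}"
    moreover have "finprod G (\<lambda>x. x [^]\<^bsub>G\<^esub> (1::int)) B = \<one>\<^bsub>G\<^esub>"
      using B c by (intro finprod_one_eqI) (auto simp: independent_in_def)
    moreover have "\<forall>x\<in>B. (1::int) = 0" if "finprod G (\<lambda>x. x [^]\<^bsub>G\<^esub> (1::int)) B = \<one>\<^bsub>G\<^esub>"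
      using B that unfolding independent_in_def by (elim conjE allE[of _ "\<lambda>_. 1"]) blast
    ultimately show False by auto
  qed
  then have "abelian_rank G \<le> 0" by (intro abelian_rank_leI) (metis card.empty order_refl zero_enat_def)
  then show ?thesis by simp
qed

text \<open>This is \<open>abelian_rank_exact\<close> with a trivial group on the left, which covers
  the trivial kernel and contributes rank 0.\<close>

lemma abelian_rank_mon:
  assumes gr: "comm_group A" "comm_group C" and h: "h \<in> hom A C" "inj_on h (carrier A)"
  shows "abelian_rank A \<le> abelian_rank C"
proof -
  interpret A: comm_group A by fact
  interpret C: comm_group C by fact
  have t: "trivial_group (singleton_group \<one>\<^bsub>A\<^esub>)" by simp
  have "comm_group (singleton_group \<one>\<^bsub>A\<^esub>)" by simp
  moreover have "(\<lambda>_. \<one>\<^bsub>A\<^esub>) \<in> hom (singleton_group \<one>\<^bsub>A\<^esub>) A" by (simp add: hom_def)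
  moreover have "kernel A C h \<subseteq> (\<lambda>_. \<one>\<^bsub>A\<^esub>) ` carrier (singleton_group \<one>\<^bsub>A\<^esub>)"
    using h by (force simp: kernel_def singleton_group_def inj_on_def hom_one[OF h(1) A.group_axioms C.group_axioms])
  ultimately have "abelian_rank A \<le> abelian_rank (singleton_group \<one>\<^bsub>A\<^esub>) + abelian_rank C"
    by (intro abelian_rank_exact[OF _ gr _ h(1)])
  then show ?thesis by (simp add: abelian_rank_trivial_group[OF t])
qed

lemma abelian_rank_iso:
  assumes "comm_group A" "comm_group C" "A \<cong> C"
  shows "abelian_rank A = abelian_rank C"
proof (rule antisym)
  show "abelian_rank A \<le> abelian_rank C"
    using assms by (auto simp: is_iso_def iso_def bij_betw_def intro: abelian_rank_mon)
  have "C \<cong> A" using assms group.iso_sym comm_group.axioms(2) by blast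
  then show "abelian_rank C \<le> abelian_rank A"
    using assms by (auto simp: is_iso_def iso_def bij_betw_def intro: abelian_rank_mon)
qed

lemma abelian_rank_integer_group: "abelian_rank integer_group \<le> 1"
proof (rule abelian_rank_leI)
  interpret Z: comm_group integer_group by (rule abelian_integer_group)
  fix B assume B: "independent_in integer_group B"
  have "a = b" if ab: "a \<in> B" "b \<in> B" for a b
  proof (rule ccontr)
    assume "a \<noteq> b"
    \<comment> \<open>The relation \<open>b * a + (- a) * b = 0\<close> is nontrivial, because
      distinct integers are not both zero.\<close>
    define k where "k x = (if x = a then b else if x = b then - a else (0::int))" for x
    have fin: "finite B" using B by (simp add: independent_in_def)
    have "finprod integer_group (\<lambda>x. x [^]\<^bsub>integer_group\<^esub> k x) B
        = finprod integer_group (\<lambda>x. x [^]\<^bsub>integer_group\<^esub> k x) {a, b}"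
      using fin ab by (intro Z.finprod_mono_neutral_cong_right) (auto simp: k_def)
    also have "\<dots> = \<one>\<^bsub>integer_group\<^esub>"
      using \<open>a \<noteq> b\<close> by (simp add: k_def)
    finally have "k a = 0" "k b = 0" using B ab by (auto simp: independent_in_def)
    then have "a = 0" "b = 0" using \<open>a \<noteq> b\<close> by (auto simp: k_def)
    with \<open>a \<noteq> b\<close> show False by simp
  qed
  then have "card B \<le> 1" by (metis card_le_Suc0_iff_eq B One_nat_def independent_in_def)
  then show "enat (card B) \<le> 1" by (simp add: one_enat_def)
qed

text \<open>A combination of the generators evaluated at \<open>i\<close> returns its coefficient
  there. The lemma serves the zeroth homology group, which is free on the path components.\<close>

lemma card_le_abelian_rank_free_Abelian_group:
  assumes "finite I" "I \<subseteq> S"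
  shows "enat (card I) \<le> abelian_rank (free_Abelian_group S)"
proof (rule card_le_abelian_rank[OF abelian_free_Abelian_group, where x = frag_of])
  interpret comm_group "free_Abelian_group S" by (rule abelian_free_Abelian_group)
  have *: "finprod (free_Abelian_group S) (\<lambda>i. frag_of i [^]\<^bsub>free_Abelian_group S\<^esub> k i) J
     = (\<Sum>i\<in>J. frag_cmul (k i) (frag_of i))" if "finite J" "J \<subseteq> S" for J and k :: "_ \<Rightarrow> int"
    using that
  proof (induction J rule: finite_induct)
    case (insert a J)
    then have c: "frag_of i \<in> carrier (free_Abelian_group S)" if "i \<in> insert a J" for i
      using that by auto
    have "(\<lambda>i. frag_of i [^]\<^bsub>free_Abelian_group S\<^esub> k i) \<in> J \<rightarrow> carrier (free_Abelian_group S)"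
      using c by (intro Pi_I int_pow_closed) auto
    moreover have "frag_of a [^]\<^bsub>free_Abelian_group S\<^esub> k a \<in> carrier (free_Abelian_group S)"
      using c by (intro int_pow_closed) auto
    ultimately show ?case using insert by (subst finprod_insert) auto
  qed auto
  show "independent_family (free_Abelian_group S) frag_of I"
    unfolding independent_family_def
  proof (intro conjI allI impI ballI)
    fix k :: "_ \<Rightarrow> int" and i
    assume "finprod (free_Abelian_group S) (\<lambda>i. frag_of i [^]\<^bsub>free_Abelian_group S\<^esub> k i) I
        = \<one>\<^bsub>free_Abelian_group S\<^esub>" and i: "i \<in> I"
    then have "Poly_Mapping.lookup (\<Sum>i\<in>I. frag_cmul (k i) (frag_of i)) i = 0"
      using *[OF assms] by simp
    then have "(\<Sum>j\<in>I. k j * (if i = j then 1 else 0)) = 0"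
      by (simp add: lookup_sum Poly_Mapping.lookup_single when_def)
    then show "k i = 0" using assms(1) i by (simp add: if_distrib[of "(*) _"] cong: if_cong)
  qed (use assms in auto)
qed

section \<open>Betti numbers of unions of open convex sets\<close>

text \<open>The inclusion followed by the retraction is the identity of \<open>S\<close>, so the
  inclusion is injective on homology and the rank is monotone.\<close>

lemma betti_retract:
  assumes "S \<subseteq> K" "continuous_on K \<rho>" "\<rho> ` K \<subseteq> S" "\<And>x. x \<in> S \<Longrightarrow> \<rho> x = x"
  shows "betti p (top_of_set S) \<le> betti p (top_of_set K)"
proof -
  have eq: "subtopology (top_of_set K) S = top_of_set S"
    using assms(1) by (simp add: subtopology_subtopology Int_absorb1)
  have "S retract_of_space top_of_set K"
    unfolding retract_of_space_def eq
    using assms by (intro conjI exI[of _ \<rho>]) auto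
  then have "inj_on (hom_induced (int p) (subtopology (top_of_set K) S) {} (top_of_set K) {} id)
      (carrier (homology_group (int p) (subtopology (top_of_set K) S)))"
    by (intro inj_on_hom_induced_inclusion) simp
  then show ?thesis
    unfolding betti_def eq
    by (rule abelian_rank_mon[OF abelian_homology_group abelian_homology_group hom_induced_hom])
qed

text \<open>The inequality of Mayer-Vietoris type, obtained from two long exact sequences: that of
  the pair \<open>(U \<union> V, U)\<close>, and, after excision, that of
  \<open>(V, U \<inter> V)\<close>.\<close>

lemma betti_Un_open:
  assumes "open U" "open V"
  shows "betti p (top_of_set (U \<union> V)) \<le> betti p (top_of_set U) + (betti p (top_of_set V)
           + (if p = 0 then 0 else betti (p - 1) (top_of_set (U \<inter> V))))"
proof -
  define X where "X = top_of_set (U \<union> V)"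
  have XU: "subtopology X U = top_of_set U" and XV: "subtopology X V = top_of_set V"
    and XX: "subtopology X (U \<union> V) = X"
    by (simp_all add: X_def subtopology_subtopology Int_absorb1)
  have oU: "openin X U" and oV: "openin X V"
    using assms by (auto simp: X_def openin_open)
  have top: "topspace X = U \<union> V" by (simp add: X_def)
  have 1: "betti p X \<le> betti p (top_of_set U) + abelian_rank (relative_homology_group (int p) X U)"
    using homology_exactness_axiom_3[of "int p" X U]
    unfolding betti_def XU
    by (intro abelian_rank_exact[OF _ _ _ _ _ equalityD1]) auto
  \<comment> \<open>The excised set \<open>U - V\<close> is the complement of \<open>V\<close> in
    \<open>X\<close>. It is closed and contained in the open set \<open>U\<close>, as excision
    demands, and what remains is the pair of \<open>V\<close> and
    \<open>U \<inter> V\<close>.\<close>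
  have "closedin X (topspace X - V)" by (intro closedin_diff closedin_topspace oV)
  then have "closedin X (U - V)" by (simp add: top Un_Diff)
  then have "X closure_of (U - V) \<subseteq> X interior_of U"
    using oU by (simp add: closure_of_closedin interior_of_openin)
  from homology_excision_axiom[OF this, of "U \<union> V" "int p"]
  have "relative_homology_group (int p) (subtopology X ((U \<union> V) - (U - V))) (U - (U - V))
      \<cong> relative_homology_group (int p) (subtopology X (U \<union> V)) U"
    unfolding is_iso_def by blast
  moreover have "(U \<union> V) - (U - V) = V" "U - (U - V) = U \<inter> V" by auto
  ultimately have "relative_homology_group (int p) (subtopology X V) (U \<inter> V) \<cong> relative_homology_group (int p) X U"
    by (simp only: XX)
  then have "abelian_rank (relative_homology_group (int p) X U)
      = abelian_rank (relative_homology_group (int p) (top_of_set V) (U \<inter> V))"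
    unfolding XV by (intro abelian_rank_iso[symmetric]) auto
  also have "\<dots> \<le> betti p (top_of_set V) + abelian_rank (homology_group (int p - 1) (subtopology (top_of_set V) (U \<inter> V)))"
    using homology_exactness_axiom_1[of "int p" "top_of_set V" "U \<inter> V"]
    unfolding betti_def
    by (intro abelian_rank_exact[OF _ _ _ _ _ equalityD1]) auto
  \<comment> \<open>For \<open>p = 0\<close> the boundary map lands in degree -1, where homology is
    trivial. The case split is needed because \<open>p - 1\<close> on naturals would be read as
    degree 0.\<close>
  also have "abelian_rank (homology_group (int p - 1) (subtopology (top_of_set V) (U \<inter> V)))
      = (if p = 0 then 0 else betti (p - 1) (top_of_set (U \<inter> V)))"
    by (auto simp: betti_def abelian_rank_trivial_group subtopology_subtopology Int_absorb1 of_nat_diff)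
  finally show ?thesis
    using 1 unfolding X_def by (meson add_left_mono order_trans)
qed

text \<open>An infinite sum in \<open>enat\<close> is the supremum of its finite partial sums. All
  estimates of the total Betti number are made degree by degree through this criterion.\<close>

lemma total_betti_le_iff:
  "total_betti S \<le> n \<longleftrightarrow> (\<forall>P. (\<Sum>p<P. betti p (top_of_set S)) \<le> n)"
proof
  assume *: "\<forall>P. (\<Sum>p<P. betti p (top_of_set S)) \<le> n"
  have "sum (\<lambda>p. betti p (top_of_set S)) F \<le> n" if F: "finite F" for F
  proof -
    have "F \<subseteq> {..<Suc (Max F)}" using F by (auto simp: less_Suc_eq_le)
    then have "sum (\<lambda>p. betti p (top_of_set S)) F \<le> (\<Sum>p<Suc (Max F). betti p (top_of_set S))"
      by (intro sum_mono2) auto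
    then show ?thesis using * order_trans by blast
  qed
  then show "total_betti S \<le> n"
    unfolding total_betti_def by (subst nonneg_infsum_complete) (auto intro!: SUP_least)
next
  assume *: "total_betti S \<le> n"
  show "\<forall>P. (\<Sum>p<P. betti p (top_of_set S)) \<le> n"
  proof
    fix P
    have "(\<Sum>p<P. betti p (top_of_set S)) \<le> total_betti S"
      unfolding total_betti_def by (subst nonneg_infsum_complete) (auto intro!: SUP_upper)
    then show "(\<Sum>p<P. betti p (top_of_set S)) \<le> n" using * by simp
  qed
qed

lemma total_betti_retract:
  assumes "S \<subseteq> K" "continuous_on K \<rho>" "\<rho> ` K \<subseteq> S" "\<And>x. x \<in> S \<Longrightarrow> \<rho> x = x"
  shows "total_betti S \<le> total_betti K"
  unfolding total_betti_le_iff
proof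
  fix P
  have "(\<Sum>p<P. betti p (top_of_set S)) \<le> (\<Sum>p<P. betti p (top_of_set K))"
    using assms by (intro sum_mono betti_retract)
  then show "(\<Sum>p<P. betti p (top_of_set S)) \<le> total_betti K"
    using total_betti_le_iff[of K "total_betti K"] by (auto intro: order_trans)
qed

lemma total_betti_Un_open:
  assumes "open U" "open V"
  shows "total_betti (U \<union> V) \<le> total_betti U + (total_betti V + total_betti (U \<inter> V))"
  unfolding total_betti_le_iff
proof
  fix P
  let ?b = "\<lambda>S p. betti p (top_of_set S)"
  have le: "(\<Sum>p<P. ?b S p) \<le> total_betti S" for S P
    using total_betti_le_iff[of S "total_betti S"] by auto
  \<comment> \<open>The shift by one degree is harmless: the term for \<open>p = 0\<close> is zero,
    and the others form a shorter partial sum for \<open>U \<inter> V\<close>.\<close>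
  have "(\<Sum>p<P. if p = 0 then 0 else ?b (U \<inter> V) (p - 1)) \<le> total_betti (U \<inter> V)"
  proof (cases P)
    case (Suc Q)
    then show ?thesis using le[of "U \<inter> V" Q]
      by (simp add: lessThan_Suc_eq_insert_0 sum.reindex del: sum.lessThan_Suc)
  qed simp
  moreover have "(\<Sum>p<P. ?b (U \<union> V) p) \<le> (\<Sum>p<P. ?b U p + (?b V p
           + (if p = 0 then 0 else ?b (U \<inter> V) (p - 1))))"
    by (intro sum_mono betti_Un_open assms)
  ultimately show "(\<Sum>p<P. ?b (U \<union> V) p) \<le> total_betti U + (total_betti V + total_betti (U \<inter> V))"
    using le[of U P] le[of V P] by (simp add: sum.distrib) (meson add_mono order_trans)
qed

lemma total_betti_empty: "total_betti ({} :: 'a::topological_space set) = 0"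
proof -
  have "betti p (top_of_set ({} :: 'a set)) = 0" for p
    unfolding betti_def by (intro abelian_rank_trivial_group trivial_homology_group_empty) simp
  then have "total_betti ({} :: 'a set) \<le> 0" unfolding total_betti_le_iff by simp
  then show ?thesis by simp
qed

text \<open>A nonempty convex set is contractible and path connected, so only degree 0 contributes,
  with rank at most 1. The inequality also admits the empty set.\<close>

lemma total_betti_convex:
  fixes S :: "'a::real_normed_vector set"
  assumes "convex S"
  shows "total_betti S \<le> 1"
proof (cases "S = {}")
  case False
  have "contractible_space (top_of_set S)"
    using convex_imp_contractible[OF assms] by simp
  then have "betti p (top_of_set S) = 0" if "p > 0" for p
    using trivial_reduced_homology_group_contractible_space[of "top_of_set S" "int p"] that
    by (simp add: betti_def un_reduced_homology_group abelian_rank_trivial_group)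
  moreover have "betti 0 (top_of_set S) \<le> 1"
  proof -
    have "path_connected_space (top_of_set S)"
      using convex_imp_path_connected[OF assms]
      by (metis path_connectedin_def path_connectedin_euclidean)
    then have "homology_group 0 (top_of_set S) \<cong> integer_group"
      using False by (intro isomorphic_integer_zeroth_homology_group) auto
    from abelian_rank_iso[OF abelian_homology_group abelian_integer_group this]
    show ?thesis using abelian_rank_integer_group by (simp add: betti_def)
  qed
  moreover have "(\<Sum>p<P. betti p (top_of_set S)) \<le> betti 0 (top_of_set S) + (\<Sum>p\<in>{0<..<P}. betti p (top_of_set S))" for P
  proof -
    have "(\<Sum>p<P. betti p (top_of_set S)) \<le> (\<Sum>p\<in>insert 0 {0<..<P}. betti p (top_of_set S))"
      by (intro sum_mono2) auto
    then show ?thesis by simp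
  qed
  ultimately show ?thesis
    unfolding total_betti_le_iff by (auto intro: order_trans)
qed (simp add: total_betti_empty)

text \<open>The induction adds one set at a time; the new intersection is again a union of convex
  sets, so that the subfamilies split according to whether they contain the new index.\<close>

lemma total_betti_Union_convex:
  fixes A :: "'i \<Rightarrow> 'a::real_normed_vector set"
  assumes "finite I" "\<And>i. i \<in> I \<Longrightarrow> open (A i)" "\<And>i. i \<in> I \<Longrightarrow> convex (A i)"
  shows "total_betti (\<Union>i\<in>I. A i) \<le> enat (card {J. J \<subseteq> I \<and> J \<noteq> {} \<and> (\<Inter>j\<in>J. A j) \<noteq> {}})"
  using assms
proof (induction I arbitrary: A rule: finite_induct)
  case empty
  then show ?case by (simp add: total_betti_empty)
next
  case (insert q I)
  define N where "N K A = {J. J \<subseteq> K \<and> J \<noteq> {} \<and> (\<Inter>j\<in>J. A j) \<noteq> {}}"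
    for K and A :: "'i \<Rightarrow> 'a set"
  have fin: "finite (N K A)" if "finite K" for K and A :: "'i \<Rightarrow> 'a set"
    using that by (auto simp: N_def intro: finite_subset[OF _ finite_Pow_iff[THEN iffD2]])
  let ?Q = "{J. J = {q} \<and> A q \<noteq> {}}"
  have Int: "(\<Union>i\<in>I. A i) \<inter> A q = (\<Union>i\<in>I. A i \<inter> A q)" by auto
  have "total_betti (\<Union>i\<in>insert q I. A i) = total_betti ((\<Union>i\<in>I. A i) \<union> A q)"
    by (simp add: Un_commute)
  also have "\<dots> \<le> total_betti (\<Union>i\<in>I. A i) + (total_betti (A q) + total_betti ((\<Union>i\<in>I. A i) \<inter> A q))"
    using insert.prems by (intro total_betti_Un_open open_UN) auto
  also have "\<dots> \<le> enat (card (N I A)) + (enat (card ?Q) + enat (card (N I (\<lambda>i. A i \<inter> A q))))"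
  proof (intro add_mono)
    show "total_betti (\<Union>i\<in>I. A i) \<le> enat (card (N I A))"
      using insert by (auto simp: N_def)
    show "total_betti (A q) \<le> enat (card ?Q)"
    proof (cases "A q = {}")
      case False
      then have "?Q = {{q}}" by auto
      then show ?thesis using total_betti_convex[of "A q"] insert.prems by (simp add: one_enat_def)
    qed (simp add: total_betti_empty)
    show "total_betti ((\<Union>i\<in>I. A i) \<inter> A q) \<le> enat (card (N I (\<lambda>i. A i \<inter> A q)))"
      unfolding Int N_def using insert.prems by (intro insert.IH) (auto intro: convex_Int)
  qed
  \<comment> \<open>Since \<open>q\<close> is not in \<open>I\<close>, adjoining \<open>q\<close> is
    injective on the families counted by the last term. The three collections are then pairwise
    disjoint: families without \<open>q\<close>, the family \<open>{q}\<close>, and larger families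
    with \<open>q\<close>.\<close>
  also have "\<dots> = enat (card (N I A) + (card ?Q + card (Set.insert q ` N I (\<lambda>i. A i \<inter> A q))))"
  proof -
    have "inj_on (Set.insert q) (N I (\<lambda>i. A i \<inter> A q))"
      using insert.hyps(2) by (auto simp: N_def intro!: inj_onI dest: insert_ident[THEN iffD1, rotated 2])
    then show ?thesis by (simp add: card_image)
  qed
  also have "\<dots> = enat (card (N I A \<union> (?Q \<union> Set.insert q ` N I (\<lambda>i. A i \<inter> A q))))"
  proof -
    have "?Q \<inter> Set.insert q ` N I (\<lambda>i. A i \<inter> A q) = {}"
      using insert.hyps(2) by (auto simp: N_def insert_eq_iff)
    moreover have "N I A \<inter> (?Q \<union> Set.insert q ` N I (\<lambda>i. A i \<inter> A q)) = {}"
      using insert.hyps(2) by (auto simp: N_def)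
    ultimately show ?thesis
      using fin[OF insert.hyps(1)] by (simp add: card_Un_disjoint)
  qed
  also have "\<dots> \<le> enat (card (N (insert q I) A))"
    using insert.hyps(1) by (auto simp: N_def intro!: card_mono fin[unfolded N_def])
  finally show ?case by (simp add: N_def)
qed

text \<open>Points of \<open>S\<close> in different sets \<open>U i\<close> lie in different path
  components, because a connected subset of \<open>S\<close> joining them would be split by
  \<open>U i\<close> and the union of the other sets. The rank of the zeroth homology counts path
  components.\<close>

lemma card_le_total_betti:
  assumes "finite I" "disjoint_family_on U I" "S \<subseteq> (\<Union>i\<in>I. U i)"
    and "\<And>i. i \<in> I \<Longrightarrow> open (U i)" "\<And>i. i \<in> I \<Longrightarrow> S \<inter> U i \<noteq> {}"
  shows "enat (card I) \<le> total_betti S"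
proof -
  let ?X = "top_of_set S"
  obtain x where x: "\<And>i. i \<in> I \<Longrightarrow> x i \<in> S \<inter> U i"
    using bchoice[of I "\<lambda>i y. y \<in> S \<inter> U i"] assms(5) by blast
  let ?C = "\<lambda>i. path_component_of_set ?X (x i)"
  have inj: "inj_on ?C I"
  proof (rule inj_onI, rule ccontr)
    fix i j assume ij: "i \<in> I" "j \<in> I" "?C i = ?C j" "i \<noteq> j"
    have "path_component_of ?X (x j) (x j)"
      using x[OF ij(2)] by (simp add: path_component_of_refl)
    with ij(3) have "path_component_of ?X (x i) (x j)" by blast
    then have "connected_component_of ?X (x i) (x j)"
      by (rule path_imp_connected_component_of)
    then obtain T where T: "connected T" "T \<subseteq> S" "x i \<in> T" "x j \<in> T"
      by (auto simp: connected_component_of_def connectedin_subtopology)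
    have "open (U i)" "open (\<Union>l\<in>I - {i}. U l)" using assms(4) ij by auto
    moreover have "T \<subseteq> U i \<union> (\<Union>l\<in>I - {i}. U l)" using T(2) assms(3) by auto
    moreover have "U i \<inter> (\<Union>l\<in>I - {i}. U l) \<inter> T = {}"
      using assms(2) ij(1) by (fastforce simp: disjoint_family_on_def)
    moreover have "x i \<in> U i \<inter> T" "x j \<in> (\<Union>l\<in>I - {i}. U l) \<inter> T" using x ij T by auto
    ultimately show False using connectedD[OF T(1)] by blast
  qed
  have "?C ` I \<subseteq> path_components_of ?X"
    using x by (auto simp: path_components_of_def)
  then have "enat (card (?C ` I)) \<le> abelian_rank (free_Abelian_group (path_components_of ?X))"
    using assms(1) by (intro card_le_abelian_rank_free_Abelian_group) auto
  also have "\<dots> = betti 0 ?X"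
    using abelian_rank_iso[OF abelian_homology_group abelian_free_Abelian_group zeroth_homology_group, of ?X]
    by (simp add: betti_def)
  also have "\<dots> = (\<Sum>p<1. betti p ?X)" by simp
  also have "\<dots> \<le> total_betti S"
    using total_betti_le_iff[of S "total_betti S"] by blast
  finally show ?thesis by (simp add: card_image[OF inj])
qed

section \<open>Retracting a band onto the zero set\<close>

lemma onorm_inner_le:
  fixes a :: "'a::real_inner"
  assumes "norm a \<le> K"
  shows "onorm (\<lambda>h. a \<bullet> h) \<le> K"
proof (rule onorm_bound)
  show "0 \<le> K" using assms norm_ge_zero order_trans by blast
  fix h
  have "\<bar>a \<bullet> h\<bar> \<le> norm a * norm h" by (rule Cauchy_Schwarz_ineq2)
  also have "\<dots> \<le> K * norm h" using assms by (rule mult_right_mono) simp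
  finally show "norm (a \<bullet> h) \<le> K * norm h" by simp
qed

text \<open>The step \<open>x - t f(x) \<nabla>f(x)\<close> with a small fixed \<open>t\<close> contracts \<open>f\<close> towards \<open>0\<close> by a
  uniform factor, so that its iterates converge uniformly, and the limit is the retraction.\<close>

lemma retraction_onto_zero_set:
  fixes f :: "'a::euclidean_space \<Rightarrow> real" and G :: "'a \<Rightarrow> 'a"
  assumes D: "compact D" "convex D"
    and f: "\<And>x. x \<in> D \<Longrightarrow> (f has_derivative (\<lambda>h. G x \<bullet> h)) (at x within D)"
    and G: "continuous_on D G"
    and W: "{x \<in> D. \<bar>f x\<bar> \<le> a} \<subseteq> interior D" and a: "a \<ge> 0"
    and nz: "\<And>x. x \<in> D \<Longrightarrow> \<bar>f x\<bar> \<le> a \<Longrightarrow> G x \<noteq> 0"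
  obtains \<rho> where "continuous_on {x \<in> D. \<bar>f x\<bar> \<le> a} \<rho>"
    "\<And>x. x \<in> D \<Longrightarrow> \<bar>f x\<bar> \<le> a \<Longrightarrow> \<rho> x \<in> D \<and> f (\<rho> x) = 0"
    "\<And>x. x \<in> D \<Longrightarrow> f x = 0 \<Longrightarrow> \<rho> x = x"
proof -
  define W where "W = {x \<in> D. \<bar>f x\<bar> \<le> a}"
  have WD: "W \<subseteq> D" by (auto simp: W_def)
  have contf: "continuous_on D f"
    using f has_derivative_continuous continuous_on_eq_continuous_within by blast
  have "W = D \<inter> (\<lambda>x. \<bar>f x\<bar>) -` {..a}" by (auto simp: W_def)
  moreover have "closed (D \<inter> (\<lambda>x. \<bar>f x\<bar>) -` {..a})"
    by (rule continuous_closed_preimage) (use D contf in \<open>auto intro!: continuous_intros compact_imp_closed\<close>)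
  ultimately have "closed W" by simp
  then have cW: "compact W" using compact_Int_closed[OF D(1), of W] WD by (simp add: Int_absorb1)
  \<comment> \<open>A step shorter than \<open>e\<close> that starts in \<open>W\<close> cannot
    leave \<open>D\<close>.\<close>
  obtain e where e: "e > 0" "(\<Union>x\<in>W. ball x e) \<subseteq> interior D"
    using compact_subset_open_imp_ball_epsilon_subset[OF cW open_interior] W unfolding W_def by blast
  obtain M where M: "M > 0" "\<And>x. x \<in> D \<Longrightarrow> norm (G x) \<le> M"
    using compact_imp_bounded[OF compact_continuous_image[OF G D(1)]]
    by (auto simp: bounded_pos)
  obtain \<mu> where \<mu>: "\<mu> > 0" "\<And>x. x \<in> W \<Longrightarrow> (norm (G x))\<^sup>2 \<ge> \<mu>"
  proof (cases "W = {}")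
    case False
    have "continuous_on W (\<lambda>x. (norm (G x))\<^sup>2)"
      using continuous_on_subset[OF G WD] by (intro continuous_intros)
    from continuous_attains_inf[OF cW False this]
    obtain x where "x \<in> W" "\<And>y. y \<in> W \<Longrightarrow> (norm (G x))\<^sup>2 \<le> (norm (G y))\<^sup>2" by blast
    moreover have "G x \<noteq> 0" using \<open>x \<in> W\<close> nz by (auto simp: W_def)
    ultimately show ?thesis using that[of "(norm (G x))\<^sup>2"] by simp
  qed (use that[of 1] in auto)
  have "uniformly_continuous_on D G" by (rule compact_uniformly_continuous[OF G D(1)])
  \<comment> \<open>Times the maximal step length \<open>t * \<bar>f x\<bar> * M\<close>, this
    tolerance gives an error of \<open>t * \<mu> / 2 * \<bar>f x\<bar>\<close>, half of the decrease
    guaranteed to first order.\<close>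
  moreover have "\<mu> / (2 * M) > 0" using \<mu> M by simp
  ultimately obtain d where d: "d > 0"
    "\<And>x y. x \<in> D \<Longrightarrow> y \<in> D \<Longrightarrow> dist y x < d \<Longrightarrow> dist (G y) (G x) < \<mu> / (2 * M)"
    unfolding uniformly_continuous_on_def by meson
  have aM: "a * M \<ge> 0" using a M by simp
  \<comment> \<open>The first bound keeps \<open>1 - t * (norm (G x))\<^sup>2\<close> nonnegative;
    the second keeps every step shorter than \<open>e\<close> and \<open>d\<close>. The summand 1
    covers the case \<open>a = 0\<close>.\<close>
  define t where "t = min (1 / M\<^sup>2) (min e d / (a * M + 1))"
  have t: "t > 0" using M e d aM by (simp add: t_def add_nonneg_pos)
  have tM: "t * M\<^sup>2 \<le> 1"
  proof -
    have "t \<le> 1 / M\<^sup>2" by (simp add: t_def)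
    then show ?thesis using M by (simp add: field_simps)
  qed
  have taM: "t * (a * M) < min e d"
  proof -
    have "t * (a * M) < t * (a * M + 1)" using t by simp
    also have "t \<le> min e d / (a * M + 1)" by (simp add: t_def)
    then have "t * (a * M + 1) \<le> min e d" using aM by (simp add: pos_le_divide_eq)
    finally show ?thesis .
  qed
  define \<phi> where "\<phi> x = x - (t * f x) *\<^sub>R G x" for x
  define q where "q = 1 - t * \<mu> / 2"
  have q1: "q < 1" using t \<mu> by (simp add: q_def)
  have nphi: "norm (\<phi> x - x) \<le> t * \<bar>f x\<bar> * M" if "x \<in> W" for x
    using M(2)[of x] WD that t by (auto simp: \<phi>_def abs_mult intro!: mult_left_mono)
  have step: "\<phi> x \<in> D" "\<bar>f (\<phi> x)\<bar> \<le> q * \<bar>f x\<bar>" if x: "x \<in> W" for x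
  proof -
    have xD: "x \<in> D" using x WD by blast
    have "t * \<bar>f x\<bar> * M \<le> t * (a * M)"
      using x t M by (auto simp: W_def mult.assoc intro!: mult_left_mono mult_right_mono)
    then have close: "norm (\<phi> x - x) < min e d" using nphi[OF x] taM by linarith
    then have "\<phi> x \<in> ball x e" by (simp add: dist_norm norm_minus_commute)
    then show pD: "\<phi> x \<in> D" using e(2) x interior_subset by blast
    \<comment> \<open>Removing the linear part at \<open>x\<close> leaves a function with derivative
      \<open>G y - G x\<close>, which is small near \<open>x\<close>; the mean value inequality then
      bounds the first-order error.\<close>
    define F where "F y = f y - G x \<bullet> y" for y
    have "norm (F (\<phi> x) - F x) \<le> \<mu> / (2 * M) * norm (\<phi> x - x)"
    proof (rule differentiable_bound[of "D \<inter> ball x d" F "\<lambda>y h. (G y - G x) \<bullet> h"])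
      show "convex (D \<inter> ball x d)" using D by (intro convex_Int) auto
      fix y assume y: "y \<in> D \<inter> ball x d"
      have "(f has_derivative (\<lambda>h. G y \<bullet> h)) (at y within D \<inter> ball x d)"
        using f[of y] y by (auto intro: has_derivative_subset)
      then show "(F has_derivative (\<lambda>h. (G y - G x) \<bullet> h)) (at y within D \<inter> ball x d)"
        unfolding F_def by (auto intro!: derivative_eq_intros simp: inner_diff_left)
      have "norm (G y - G x) \<le> \<mu> / (2 * M)"
        using d(2)[of x y] xD y by (auto simp: dist_norm norm_minus_commute less_imp_le)
      then show "onorm (\<lambda>h. (G y - G x) \<bullet> h) \<le> \<mu> / (2 * M)"
        by (rule onorm_inner_le)
    qed (use close xD pD d in \<open>auto simp: dist_norm norm_minus_commute\<close>)
    also have "\<dots> \<le> \<mu> / (2 * M) * (t * \<bar>f x\<bar> * M)"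
      using nphi[OF x] \<mu> M by (intro mult_left_mono) auto
    also have "\<dots> = t * \<mu> / 2 * \<bar>f x\<bar>" using M by (simp add: field_simps)
    finally have "\<bar>F (\<phi> x) - F x\<bar> \<le> t * \<mu> / 2 * \<bar>f x\<bar>" by simp
    moreover have "F (\<phi> x) - F x = f (\<phi> x) - (1 - t * (norm (G x))\<^sup>2) * f x"
      by (simp add: F_def \<phi>_def inner_diff_right power2_norm_eq_inner algebra_simps)
    moreover have "\<bar>(1 - t * (norm (G x))\<^sup>2) * f x\<bar> \<le> (1 - t * \<mu>) * \<bar>f x\<bar>"
    proof -
      have "(norm (G x))\<^sup>2 \<le> M\<^sup>2" using M(2)[OF xD] by (intro power_mono) auto
      then have "t * (norm (G x))\<^sup>2 \<le> 1" using tM t by (meson mult_left_mono less_imp_le order_trans)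
      moreover have "t * \<mu> \<le> t * (norm (G x))\<^sup>2" using \<mu>(2)[OF x] t by simp
      ultimately show ?thesis by (auto simp: abs_mult intro!: mult_right_mono)
    qed
    ultimately have "\<bar>f (\<phi> x)\<bar> \<le> t * \<mu> / 2 * \<bar>f x\<bar> + (1 - t * \<mu>) * \<bar>f x\<bar>" by linarith
    also have "\<dots> = q * \<bar>f x\<bar>" by (simp add: q_def algebra_simps)
    finally show "\<bar>f (\<phi> x)\<bar> \<le> q * \<bar>f x\<bar>" .
  qed
  \<comment> \<open>If \<open>W\<close> is empty, nothing bounds \<open>\<mu>\<close> from above and
    \<open>q\<close> may be negative; the powers of \<open>p\<close> are safe to use in either
    case.\<close>
  define p where "p = max q 0"
  have p: "0 \<le> p" "p < 1" using q1 by (auto simp: p_def)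
  have stepp: "\<bar>f (\<phi> x)\<bar> \<le> p * \<bar>f x\<bar>" if "x \<in> W" for x
    using step(2)[OF that] by (rule order_trans) (auto simp: p_def intro!: mult_right_mono)
  have phiW: "\<phi> x \<in> W" if "x \<in> W" for x
  proof -
    have "p * \<bar>f x\<bar> \<le> 1 * \<bar>f x\<bar>" using p by (intro mult_right_mono) auto
    then show ?thesis using stepp[OF that] step(1)[OF that] that by (auto simp: W_def)
  qed
  have itW: "(\<phi> ^^ k) x \<in> W" if "x \<in> W" for k x
    using that phiW by (induction k) auto
  have itf: "\<bar>f ((\<phi> ^^ k) x)\<bar> \<le> p ^ k * a" if "x \<in> W" for k x
  proof (induction k)
    case 0 then show ?case using that by (simp add: W_def)
  next
    case (Suc k)
    have "\<bar>f ((\<phi> ^^ Suc k) x)\<bar> \<le> p * \<bar>f ((\<phi> ^^ k) x)\<bar>" using stepp[OF itW[OF that]] by simp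
    also have "\<dots> \<le> p * (p ^ k * a)" using Suc p by (intro mult_left_mono)
    finally show ?case by (simp add: mult.assoc)
  qed
  define u where "u k x = (\<phi> ^^ Suc k) x - (\<phi> ^^ k) x" for k x
  have u: "norm (u k x) \<le> (t * M * a) * p ^ k" if "x \<in> W" for k x
  proof -
    have "norm (u k x) \<le> t * \<bar>f ((\<phi> ^^ k) x)\<bar> * M" using nphi[OF itW[OF that]] by (simp add: u_def)
    also have "\<dots> \<le> t * (p ^ k * a) * M" using itf[OF that] t M by (intro mult_right_mono mult_left_mono) auto
    finally show ?thesis by (simp add: mult_ac)
  qed
  \<comment> \<open>The values of \<open>f\<close> along the orbit decay geometrically and bound the
    step lengths. The Weierstrass test thus gives uniform convergence on \<open>W\<close>, and with
    it continuity of the limit.\<close>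
  have summ: "summable (\<lambda>k. (t * M * a) * p ^ k)" using p by (intro summable_mult summable_geometric) auto
  have ul: "uniform_limit W (\<lambda>n x. \<Sum>k<n. u k x) (\<lambda>x. suminf (\<lambda>k. u k x)) sequentially"
    by (rule Weierstrass_m_test[OF u summ])
  define \<rho> where "\<rho> x = x + suminf (\<lambda>k. u k x)" for x
  have contphi: "continuous_on W \<phi>"
    unfolding \<phi>_def using contf G WD by (intro continuous_intros) (auto intro: continuous_on_subset)
  have contit: "continuous_on W (\<phi> ^^ k)" for k
  proof (induction k)
    case (Suc k)
    show ?case using continuous_on_compose2[OF contphi Suc] itW by (auto simp: o_def)
  qed simp
  have "continuous_on W (\<lambda>x. suminf (\<lambda>k. u k x))"
  proof (rule uniform_limit_theorem[OF _ ul])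
    show "\<forall>\<^sub>F n in sequentially. continuous_on W (\<lambda>x. \<Sum>k<n. u k x)"
      unfolding u_def using contit by (intro always_eventually allI continuous_intros)
  qed simp
  then have cont: "continuous_on W \<rho>" unfolding \<rho>_def by (intro continuous_intros)
  have lim: "(\<lambda>n. (\<phi> ^^ n) x) \<longlonglongrightarrow> \<rho> x" if "x \<in> W" for x
  proof -
    have "(\<lambda>n. x + (\<Sum>k<n. u k x)) \<longlonglongrightarrow> \<rho> x"
      unfolding \<rho>_def using tendsto_uniform_limitI[OF ul that] by (intro tendsto_intros)
    moreover have "x + (\<Sum>k<n. u k x) = (\<phi> ^^ n) x" for n
      unfolding u_def by (subst sum_lessThan_telescope) simp
    ultimately show ?thesis by simp
  qed
  show ?thesis
  proof (rule that[of \<rho>])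
    show "continuous_on {x \<in> D. \<bar>f x\<bar> \<le> a} \<rho>" using cont by (simp add: W_def)
    fix x assume "x \<in> D" "\<bar>f x\<bar> \<le> a"
    then have x: "x \<in> W" by (simp add: W_def)
    have rW: "\<rho> x \<in> W"
      using closed_sequentially[OF \<open>closed W\<close> _ lim[OF x]] itW[OF x] by blast
    have "(\<lambda>n. f ((\<phi> ^^ n) x)) \<longlonglongrightarrow> f (\<rho> x)"
      by (rule continuous_on_tendsto_compose[OF contf lim[OF x]]) (use rW itW[OF x] WD in \<open>auto intro!: always_eventually\<close>)
    moreover have "(\<lambda>n. f ((\<phi> ^^ n) x)) \<longlonglongrightarrow> 0"
    proof (rule Lim_null_comparison)
      show "\<forall>\<^sub>F n in sequentially. norm (f ((\<phi> ^^ n) x)) \<le> p ^ n * a" using itf[OF x] by auto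
      show "(\<lambda>n. p ^ n * a) \<longlonglongrightarrow> 0" using p by (intro tendsto_mult_left_zero LIMSEQ_power_zero) auto
    qed
    ultimately show "\<rho> x \<in> D \<and> f (\<rho> x) = 0" using rW WD LIMSEQ_unique by blast
  next
    fix x assume "x \<in> D" "f x = 0"
    then have "\<phi> x = x" by (simp add: \<phi>_def)
    then have "(\<phi> ^^ k) x = x" for k by (induction k) auto
    then show "\<rho> x = x" using \<open>\<phi> x = x\<close> by (simp add: \<rho>_def u_def)
  qed
qed

section \<open>The condition number\<close>

context
  fixes c :: "real^'n" and r :: real and f :: "real^'n \<Rightarrow> real"
  assumes r: "r > 0" and C1: "C1_on_disk c r f"
begin

lemma C1_has_derivative:
  "z \<in> cball c r \<Longrightarrow> (f has_derivative (\<lambda>h. disk_gradient c r f z \<bullet> h)) (at z within cball c r)"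
  using C1 r by (intro has_derivative_disk_gradient) (auto simp: C1_on_disk_def differentiable_on_def)

lemma C1_continuous: "continuous_on (cball c r) f" "continuous_on (cball c r) (disk_gradient c r f)"
  using C1 by (auto simp: C1_on_disk_def differentiable_imp_continuous_on)

lemma C1_norm_upper:
  assumes "z \<in> cball c r"
  shows "sqrt ((f z)\<^sup>2 + (norm (disk_gradient c r f z))\<^sup>2) \<le> C1_norm c r f"
  unfolding C1_norm_def
proof (rule cSUP_upper[OF assms])
  have "continuous_on (cball c r) (\<lambda>z. sqrt ((f z)\<^sup>2 + (norm (disk_gradient c r f z))\<^sup>2))"
    by (intro continuous_intros C1_continuous)
  then show "bdd_above ((\<lambda>z. sqrt ((f z)\<^sup>2 + (norm (disk_gradient c r f z))\<^sup>2)) ` cball c r)"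
    by (intro bounded_imp_bdd_above compact_imp_bounded compact_continuous_image) auto
qed

lemma C1_Lipschitz:
  assumes "x \<in> cball c r" "y \<in> cball c r"
  shows "\<bar>f x - f y\<bar> \<le> C1_norm c r f * norm (x - y)"
proof -
  have "onorm (\<lambda>h. disk_gradient c r f z \<bullet> h) \<le> C1_norm c r f" if "z \<in> cball c r" for z
  proof (rule onorm_inner_le)
    have "norm (disk_gradient c r f z) \<le> sqrt ((f z)\<^sup>2 + (norm (disk_gradient c r f z))\<^sup>2)"
      by (rule real_le_rsqrt) simp
    from order_trans[OF this C1_norm_upper[OF that]]
    show "norm (disk_gradient c r f z) \<le> C1_norm c r f" .
  qed
  then show ?thesis
    using differentiable_bound[of "cball c r" f "\<lambda>z h. disk_gradient c r f z \<bullet> h" "C1_norm c r f" x y]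
      C1_has_derivative assms by (auto simp: abs_minus_commute norm_minus_commute)
qed

lemma delta_le:
  "z \<in> cball c r \<Longrightarrow> delta c r f \<le> sqrt ((f z)\<^sup>2 + (norm (disk_gradient c r f z))\<^sup>2)"
  "z \<in> sphere c r \<Longrightarrow> delta c r f \<le> sqrt ((f z)\<^sup>2 + (norm (sphere_gradient c r f z))\<^sup>2)"
  unfolding delta_def
  by (rule min.coboundedI1 min.coboundedI2, rule cINF_lower, rule bdd_belowI2[of _ 0], simp_all)+

lemma sphere_gradient_formula:
  assumes "z \<in> sphere c r"
  shows "sphere_gradient c r f z
    = disk_gradient c r f z - (disk_gradient c r f z \<bullet> (z - c) / r\<^sup>2) *\<^sub>R (z - c)"
    and "(f has_derivative (\<lambda>h. sphere_gradient c r f z \<bullet> h)) (at z within sphere c r)"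
  using sphere_gradient_eq_projection[OF r assms, of f] C1 assms sphere_cball[of c r]
  by (auto simp: C1_on_disk_def differentiable_on_def)

lemma sphere_nonempty: "sphere c r \<noteq> {}"
  using r by simp

text \<open>By compactness both infima are attained, and regularity excludes the value 0. On the
  sphere, continuity of the tangential gradient comes from its formula as a projection of the full
  gradient.\<close>

lemma delta_pos:
  assumes "regular c r f"
  shows "delta c r f > 0"
proof -
  let ?g = "\<lambda>z. sqrt ((f z)\<^sup>2 + (norm (disk_gradient c r f z))\<^sup>2)"
  let ?s = "\<lambda>z. sqrt ((f z)\<^sup>2 + (norm (sphere_gradient c r f z))\<^sup>2)"
  have cf: "continuous_on (sphere c r) f" "continuous_on (sphere c r) (disk_gradient c r f)"
    using C1_continuous continuous_on_subset sphere_cball by blast+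
  have "continuous_on (sphere c r)
      (\<lambda>z. disk_gradient c r f z - (disk_gradient c r f z \<bullet> (z - c) / r\<^sup>2) *\<^sub>R (z - c))"
    using r by (intro continuous_intros cf) auto
  then have "continuous_on (sphere c r) (sphere_gradient c r f)"
    by (rule continuous_on_eq) (simp add: sphere_gradient_formula(1))
  then have "continuous_on (sphere c r) ?s" by (intro continuous_intros cf)
  then obtain w where w: "w \<in> sphere c r" "\<And>z. z \<in> sphere c r \<Longrightarrow> ?s w \<le> ?s z"
    using continuous_attains_inf[OF compact_sphere sphere_nonempty] by blast
  have "continuous_on (cball c r) ?g" by (intro continuous_intros C1_continuous)
  moreover have "cball c r \<noteq> {}" using r by simp
  ultimately obtain v where v: "v \<in> cball c r" "\<And>z. z \<in> cball c r \<Longrightarrow> ?g v \<le> ?g z"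
    using continuous_attains_inf[OF compact_cball] by blast
  have "?g v \<le> (INF z\<in>cball c r. ?g z)" using v(2) r by (intro cINF_greatest) simp_all
  moreover have "?s w \<le> (INF z\<in>sphere c r. ?s z)" using w(2) by (intro cINF_greatest sphere_nonempty)
  moreover have "?g v > 0"
  proof (cases "f v = 0")
    case True
    then show ?thesis using assms v(1) by (auto simp: regular_def zero_set_def)
  qed (simp add: add_pos_nonneg)
  moreover have "?s w > 0"
  proof (cases "f w = 0")
    case True
    then show ?thesis using assms w(1) sphere_cball[of c r] by (auto simp: regular_def zero_set_def)
  qed (simp add: add_pos_nonneg)
  ultimately show ?thesis unfolding delta_def by linarith
qed

text \<open>At a minimum of \<open>|f|\<close> on the boundary sphere the gradient of the restriction vanishes.\<close>

lemma delta_le_on_sphere: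
  assumes nz: "\<And>z. z \<in> sphere c r \<Longrightarrow> f z \<noteq> 0" and w: "w \<in> sphere c r"
  shows "delta c r f \<le> \<bar>f w\<bar>"
proof -
  have "continuous_on (sphere c r) (\<lambda>z. \<bar>f z\<bar>)"
    using C1_continuous(1) continuous_on_subset sphere_cball by (intro continuous_intros) blast
  then obtain z where z: "z \<in> sphere c r" "\<And>y. y \<in> sphere c r \<Longrightarrow> \<bar>f z\<bar> \<le> \<bar>f y\<bar>"
    using continuous_attains_inf[OF compact_sphere sphere_nonempty] by blast
  define g where "g = sphere_gradient c r f z"
  have "g = 0"
  proof (rule ccontr)
    assume "g \<noteq> 0"
    define u where "u = (r / norm g) *\<^sub>R g"
    \<comment> \<open>The great circle through \<open>z\<close> with velocity \<open>u\<close>; it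
      stays on the sphere because \<open>g\<close>, hence \<open>u\<close>, is orthogonal to the
      radius.\<close>
    define \<gamma> where "\<gamma> t = c + cos t *\<^sub>R (z - c) + sin t *\<^sub>R u" for t
    have nz': "norm (z - c) = r" using z(1) by (simp add: dist_norm norm_minus_commute)
    have nu: "norm u = r" using \<open>g \<noteq> 0\<close> r by (simp add: u_def)
    have "(z - c) \<bullet> (z - c) = r\<^sup>2" using nz' by (simp flip: power2_norm_eq_inner)
    then have "g \<bullet> (z - c) = 0"
      unfolding g_def sphere_gradient_formula(1)[OF z(1)] using r by (simp add: inner_diff_left)
    then have orth: "(z - c) \<bullet> u = 0" by (simp add: u_def inner_commute)
    have "(norm (\<gamma> t - c))\<^sup>2 = r\<^sup>2" for t
    proof -
      have "(norm (\<gamma> t - c))\<^sup>2 = (cos t)\<^sup>2 * (norm (z - c))\<^sup>2 + (sin t)\<^sup>2 * (norm u)\<^sup>2"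
        using orth unfolding \<gamma>_def power2_norm_eq_inner
        by (simp add: inner_add_left inner_add_right inner_commute[of u "z - c"] power2_eq_square)
      then show ?thesis by (simp add: nz' nu flip: distrib_right)
    qed
    then have "norm (\<gamma> t - c) = r" for t
      using r power2_eq_imp_eq[of "norm (\<gamma> t - c)" r] by simp
    then have sph: "\<gamma> t \<in> sphere c r" for t by (auto simp: dist_norm norm_minus_commute)
    have "(\<gamma> has_vector_derivative 0 + (cos 0 *\<^sub>R 0 + (- sin 0) *\<^sub>R (z - c))
        + (sin 0 *\<^sub>R 0 + cos 0 *\<^sub>R u)) (at 0)"
      unfolding \<gamma>_def
      by (intro has_vector_derivative_add has_vector_derivative_const has_vector_derivative_scaleR
          DERIV_cos DERIV_sin)
    then have d\<gamma>: "(\<gamma> has_derivative (\<lambda>h. h *\<^sub>R u)) (at 0)" by (simp add: has_vector_derivative_def)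
    have "\<gamma> 0 = z" by (simp add: \<gamma>_def)
    then have "(f has_derivative (\<lambda>h. g \<bullet> h)) (at (\<gamma> 0) within range \<gamma>)"
      unfolding g_def \<open>\<gamma> 0 = z\<close> using sph
      by (intro has_derivative_subset[OF sphere_gradient_formula(2)[OF z(1)]]) blast
    from diff_chain_within[OF d\<gamma> this]
    have "(f \<circ> \<gamma> has_field_derivative g \<bullet> u) (at 0)"
      by (simp add: o_def has_field_derivative_def mult_commute_abs)
    \<comment> \<open>Squaring makes the minimized function differentiable without regard to the
      sign of \<open>f\<close>. As \<open>f z\<close> is nonzero, the vanishing derivative yields
      \<open>g \<bullet> u = 0\<close>, against \<open>g \<bullet> u = r * norm g\<close>.\<close>
    then have "((\<lambda>t. (f (\<gamma> t))\<^sup>2) has_field_derivative 2 * f z * (g \<bullet> u)) (at 0)"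
      by (auto intro!: derivative_eq_intros simp: o_def \<open>\<gamma> 0 = z\<close>)
    moreover have "(f (\<gamma> 0))\<^sup>2 \<le> (f (\<gamma> t))\<^sup>2" for t
      using z(2)[OF sph[of t]] by (simp add: \<open>\<gamma> 0 = z\<close> abs_le_square_iff)
    ultimately have "2 * f z * (g \<bullet> u) = 0"
      using DERIV_local_min[of "\<lambda>t. (f (\<gamma> t))\<^sup>2" "2 * f z * (g \<bullet> u)" 0 1] by simp
    moreover have "g \<bullet> u = r * norm g"
      using \<open>g \<noteq> 0\<close> by (simp add: u_def flip: power2_norm_eq_inner) (simp add: power2_eq_square)
    ultimately show False using nz[OF z(1)] \<open>g \<noteq> 0\<close> r by simp
  qed
  then have "delta c r f \<le> \<bar>f z\<bar>" using delta_le(2)[OF z(1)] by (simp add: g_def)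
  then show ?thesis using z(2)[OF w] by simp
qed

lemma delta_le_C1_norm: "delta c r f \<le> C1_norm c r f"
  using delta_le(1)[of c] C1_norm_upper[of c] r by simp

lemma one_le_kappa1:
  assumes "regular c r f"
  shows "1 \<le> kappa1 c r f"
  using delta_pos[OF assms] delta_le_C1_norm by (simp add: kappa1_def)

text \<open>The radius \<open>\<epsilon> / kappa1\<close> is
  \<open>\<epsilon> * delta / C1_norm\<close>, so the Lipschitz bound allows \<open>f\<close> to
  change by at most \<open>\<epsilon> * delta\<close>. That is too little to reach the boundary,
  where \<open>|f|\<close> is at least \<open>delta\<close>.\<close>

lemma near_zero_set:
  assumes reg: "regular c r f" and Z: "zero_set c r f \<subseteq> ball c r"
    and z: "z \<in> zero_set c r f" and x: "norm (x - z) \<le> \<epsilon> / kappa1 c r f" and "\<epsilon> < 1"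
  shows "x \<in> cball c r" "\<bar>f x\<bar> \<le> \<epsilon> * delta c r f"
proof -
  let ?d = "delta c r f" and ?L = "C1_norm c r f"
  have d: "?d > 0" and L: "?L > 0" using delta_pos[OF reg] delta_le_C1_norm by auto
  have nz: "\<And>y. y \<in> sphere c r \<Longrightarrow> f y \<noteq> 0"
    using Z sphere_cball[of c r] by (fastforce simp: zero_set_def)
  have zD: "z \<in> cball c r" and fz: "f z = 0" using z by (auto simp: zero_set_def)
  have *: "?L * norm (y - z) \<le> \<epsilon> * ?d" if "norm (y - z) \<le> norm (x - z)" for y
  proof -
    have "?L * norm (y - z) \<le> ?L * (\<epsilon> / kappa1 c r f)" using that x L by (intro mult_left_mono) auto
    then show ?thesis using L by (simp add: kappa1_def)
  qed
  show xD: "x \<in> cball c r"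
  proof (rule ccontr)
    assume "x \<notin> cball c r"
    \<comment> \<open>The Lipschitz bound holds only inside the disk, so it is applied to a point
      where the segment crosses the sphere instead of to \<open>x\<close>.\<close>
    then have "closed_segment z x \<inter> frontier (cball c r) \<noteq> {}"
      using zD by (intro connected_Int_frontier) (auto simp: disjoint_iff)
    then obtain y where y: "y \<in> closed_segment z x" "y \<in> sphere c r"
      unfolding frontier_cball by blast
    have "norm (y - z) \<le> norm (x - z)" using segment_bound1[OF y(1)] by simp
    moreover have "\<bar>f y - f z\<bar> \<le> ?L * norm (y - z)"
      using y(2) zD sphere_cball by (intro C1_Lipschitz) auto
    moreover have "?d \<le> \<bar>f y\<bar>" by (rule delta_le_on_sphere[OF nz y(2)])
    ultimately have "1 * ?d \<le> \<epsilon> * ?d" using *[of y] fz by simp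
    then show False using d \<open>\<epsilon> < 1\<close> by simp
  qed
  show "\<bar>f x\<bar> \<le> \<epsilon> * ?d" using C1_Lipschitz[OF xD zD] *[of x] fz by simp
qed

end

section \<open>The upper bound\<close>

lemma card_ints_near:
  fixes x R h :: real
  assumes "h > 0" "R \<ge> 0"
  shows "finite {m::int. \<bar>x - h * m\<bar> \<le> R}"
    and "real (card {m::int. \<bar>x - h * m\<bar> \<le> R}) \<le> 2 * R / h + 1"
proof -
  have eq: "{m::int. \<bar>x - h * m\<bar> \<le> R} = {\<lceil>(x - R) / h\<rceil>..\<lfloor>(x + R) / h\<rfloor>}"
    using assms by (auto simp: ceiling_le_iff le_floor_iff abs_le_iff field_simps)
  then show "finite {m::int. \<bar>x - h * m\<bar> \<le> R}" by simp
  have "real_of_int (\<lfloor>(x + R) / h\<rfloor> - \<lceil>(x - R) / h\<rceil> + 1) \<le> (x + R) / h - (x - R) / h + 1"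
    using diff_mono[OF of_int_floor_le le_of_int_ceiling, of "(x + R) / h" "(x - R) / h"] by simp
  also have "\<dots> = 2 * R / h + 1" by (simp add: diff_divide_distrib add_divide_distrib)
  finally have "real_of_int (\<lfloor>(x + R) / h\<rfloor> - \<lceil>(x - R) / h\<rceil> + 1) \<le> 2 * R / h + 1" .
  moreover have "0 \<le> 2 * R / h + 1" using assms by simp
  ultimately show "real (card {m::int. \<bar>x - h * m\<bar> \<le> R}) \<le> 2 * R / h + 1"
    unfolding eq by (cases "\<lfloor>(x + R) / h\<rfloor> - \<lceil>(x - R) / h\<rceil> + 1 \<ge> 0") auto
qed

text \<open>Centres have spacing \<open>h\<close> but sides have length \<open>2 * h\<close>, so
  that the open cubes also cover the walls between lattice cells.\<close>

definition grid_cube :: "real \<Rightarrow> ('n \<Rightarrow> int) \<Rightarrow> (real^'n) set" where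
  "grid_cube h k = {x. \<forall>i. \<bar>x $ i - h * k i\<bar> < h}"

lemma grid_cube_eq_box:
  "grid_cube h k = box (\<chi> i. h * k i - h) (\<chi> i. h * k i + h)"
  by (auto simp: grid_cube_def mem_box_cart abs_less_iff algebra_simps)

lemma open_grid_cube: "open (grid_cube h k)"
  and convex_grid_cube: "convex (grid_cube h k)"
  by (simp_all add: grid_cube_eq_box open_box convex_box)

lemma mem_grid_cube_floor:
  assumes "h > 0"
  shows "x \<in> grid_cube h (\<lambda>i. \<lfloor>x $ i / h\<rfloor>)"
proof -
  have "\<bar>y - h * \<lfloor>y / h\<rfloor>\<bar> < h" for y
  proof -
    have "h * \<lfloor>y / h\<rfloor> \<le> h * (y / h)" "h * (y / h) < h * (\<lfloor>y / h\<rfloor> + 1)"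
      using assms by (intro mult_left_mono mult_strict_left_mono; linarith)+
    then show ?thesis using assms by (simp add: algebra_simps)
  qed
  then show ?thesis by (simp add: grid_cube_def)
qed

lemma norm_diff_grid_cube:
  fixes x y :: "real^'n" and h :: real
  assumes "x \<in> grid_cube h k" "y \<in> grid_cube h k"
  shows "norm (x - y) \<le> 2 * CARD('n) * h"
proof -
  have "\<bar>(x - y) $ i\<bar> \<le> 2 * h" for i
    using assms unfolding grid_cube_def by (auto dest!: spec[of _ i] simp: abs_less_iff abs_le_iff)
  then have "(\<Sum>i\<in>UNIV. \<bar>(x - y) $ i\<bar>) \<le> (\<Sum>i\<in>(UNIV::'n set). 2 * h)" by (intro sum_mono)
  then show ?thesis using norm_le_l1_cart[of "x - y"] by (simp add: mult_ac)
qed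

lemma grid_cube_intersect:
  assumes "x \<in> grid_cube h k" "x \<in> grid_cube h l" "h > 0"
  shows "l i \<in> {k i - 1..k i + 1}"
proof -
  have "\<bar>h * l i - h * k i\<bar> < 2 * h"
    using assms unfolding grid_cube_def by (auto dest!: spec[of _ i] simp: abs_less_iff)
  moreover have "h * l i - h * k i = h * (l i - k i)" by (simp add: algebra_simps)
  ultimately have "h * \<bar>real_of_int (l i - k i)\<bar> < h * 2" using assms(3) by (simp add: abs_mult)
  then have "\<bar>l i - k i\<bar> < 2" using assms(3) by (simp flip: of_int_diff of_int_abs)
  then show ?thesis by auto
qed

text \<open>A family with a common point lies among the \<open>3 ^ n\<close> lattice neighbours of
  any of its members, itself included. Each cube therefore accounts for at most
  \<open>2 ^ 3 ^ n\<close> families.\<close>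

lemma total_betti_Union_grid_cubes:
  fixes I :: "('n::finite \<Rightarrow> int) set"
  assumes "finite I" "h > 0"
  shows "total_betti (\<Union>k\<in>I. grid_cube h k) \<le> enat (card I * 2 ^ 3 ^ CARD('n))"
proof -
  let ?N = "\<lambda>k :: 'n \<Rightarrow> int. PiE UNIV (\<lambda>i. {k i - 1..k i + 1})"
  have finN: "finite (?N k)" for k by (intro finite_PiE) auto
  have cardN: "card (?N k) = 3 ^ CARD('n)" for k by (simp add: card_PiE)
  have "total_betti (\<Union>k\<in>I. grid_cube h k)
      \<le> enat (card {J. J \<subseteq> I \<and> J \<noteq> {} \<and> (\<Inter>j\<in>J. grid_cube h j) \<noteq> {}})"
    by (intro total_betti_Union_convex assms open_grid_cube convex_grid_cube)
  also have "card {J. J \<subseteq> I \<and> J \<noteq> {} \<and> (\<Inter>j\<in>J. grid_cube h j) \<noteq> {}} \<le> card (\<Union>k\<in>I. Pow (?N k))"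
  proof (rule card_mono)
    show "finite (\<Union>k\<in>I. Pow (?N k))" using assms(1) finN by auto
    show "{J. J \<subseteq> I \<and> J \<noteq> {} \<and> (\<Inter>j\<in>J. grid_cube h j) \<noteq> {}} \<subseteq> (\<Union>k\<in>I. Pow (?N k))"
    proof clarify
      fix J x assume J: "J \<subseteq> I" "J \<noteq> {}" "(\<Inter>j\<in>J. grid_cube h j) \<noteq> {}"
      then obtain x where x: "\<And>j. j \<in> J \<Longrightarrow> x \<in> grid_cube h j" by blast
      obtain k where k: "k \<in> J" using J(2) by blast
      have "l \<in> ?N k" if "l \<in> J" for l
        using grid_cube_intersect[OF x[OF k] x[OF that] assms(2)] by (auto simp: PiE_UNIV_domain)
      then show "J \<in> (\<Union>k\<in>I. Pow (?N k))" using k J(1) by blast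
    qed
  qed
  also have "card (\<Union>k\<in>I. Pow (?N k)) \<le> (\<Sum>k\<in>I. card (Pow (?N k)))"
    by (rule card_UN_le[OF assms(1)])
  also have "\<dots> = card I * 2 ^ 3 ^ CARD('n)" using finN by (simp add: card_Pow cardN)
  finally show ?thesis by simp
qed

lemma total_betti_zero_set_le:
  fixes c :: "real^'n"
  assumes r: "r > 0"
    and C1: "C1_on_disk c r f" and reg: "regular c r f" and Z: "zero_set c r f \<subseteq> ball c r"
  shows "ereal_of_enat (total_betti (zero_set c r f))
    \<le> ereal (2 ^ 3 ^ CARD('n) * (8 * r * CARD('n) + 3) ^ CARD('n) * kappa1 c r f ^ CARD('n))"
proof -
  let ?Z = "zero_set c r f" and ?n = "CARD('n)"
  define \<kappa> where "\<kappa> = kappa1 c r f"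
  have \<kappa>: "\<kappa> \<ge> 1" using one_le_kappa1[OF r C1 reg] by (simp add: \<kappa>_def)
  have n: "real ?n > 0" by simp
  \<comment> \<open>Chosen so that the diameter bound \<open>2 * n * h\<close> of a cube equals
    \<open>1 / (2 * \<kappa>)\<close>, the radius of \<open>near_zero_set\<close> for
    \<open>\<epsilon> = 1/2\<close>.\<close>
  define h where "h = 1 / (4 * ?n * \<kappa>)"
  have h: "h > 0" using \<kappa> n by (simp add: h_def)
  define I where "I = {k. grid_cube h k \<inter> ?Z \<noteq> {}}"
  define A where "A = PiE UNIV (\<lambda>i::'n. {m::int. \<bar>c $ i - h * m\<bar> \<le> r + h})"
  have IA: "I \<subseteq> A"
  proof
    fix k assume "k \<in> I"
    then obtain z where z: "z \<in> grid_cube h k" "z \<in> ?Z" by (auto simp: I_def)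
    have "\<bar>c $ i - h * k i\<bar> \<le> r + h" for i
    proof -
      have "\<bar>(c - z) $ i\<bar> \<le> r"
        using component_le_norm_cart[of "c - z" i] z(2) by (simp add: zero_set_def dist_norm)
      moreover have "\<bar>z $ i - h * k i\<bar> < h" using z(1) by (simp add: grid_cube_def)
      ultimately show ?thesis by (simp add: abs_le_iff abs_less_iff)
    qed
    then show "k \<in> A" by (simp add: A_def PiE_UNIV_domain)
  qed
  have finA: "finite A" unfolding A_def using h r by (intro finite_PiE card_ints_near) auto
  have "real (card A) = (\<Prod>i\<in>(UNIV::'n set). real (card {m::int. \<bar>c $ i - h * m\<bar> \<le> r + h}))"
    by (simp add: A_def card_PiE)
  also have "\<dots> \<le> (\<Prod>i\<in>(UNIV::'n set). (8 * r * ?n + 3) * \<kappa>)"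
  proof (intro prod_mono conjI)
    fix i :: 'n
    have "real (card {m::int. \<bar>c $ i - h * m\<bar> \<le> r + h}) \<le> 2 * (r + h) / h + 1"
      using h r by (intro card_ints_near) auto
    also have "\<dots> = 2 * r / h + 3" using h by (simp add: field_simps)
    also have "2 * r / h = 8 * r * ?n * \<kappa>" by (simp add: h_def)
    \<comment> \<open>As \<open>\<kappa>\<close> is at least 1, it absorbs the additive constant,
      and the bound becomes a pure power of \<open>\<kappa>\<close>.\<close>
    also have "\<dots> + 3 \<le> (8 * r * ?n + 3) * \<kappa>" using \<kappa> by (simp add: algebra_simps)
    finally show "real (card {m::int. \<bar>c $ i - h * m\<bar> \<le> r + h}) \<le> (8 * r * ?n + 3) * \<kappa>" .
  qed simp
  also have "\<dots> = (8 * r * ?n + 3) ^ ?n * \<kappa> ^ ?n" by (simp add: power_mult_distrib)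
  finally have cardA: "real (card A) \<le> (8 * r * ?n + 3) ^ ?n * \<kappa> ^ ?n" .
  define K where "K = (\<Union>k\<in>I. grid_cube h k)"
  have d: "delta c r f > 0" by (rule delta_pos[OF r C1 reg])
  let ?W = "{x \<in> cball c r. \<bar>f x\<bar> \<le> 1/2 * delta c r f}"
  have KW: "K \<subseteq> ?W"
  proof
    fix x assume "x \<in> K"
    then obtain k z where "x \<in> grid_cube h k" "z \<in> grid_cube h k" and z: "z \<in> ?Z"
      by (auto simp: K_def I_def)
    then have "norm (x - z) \<le> 2 * ?n * h" by (intro norm_diff_grid_cube)
    also have "\<dots> = (1/2) / kappa1 c r f" using n \<kappa> by (simp add: h_def \<kappa>_def field_simps)
    finally show "x \<in> ?W" using near_zero_set[OF r C1 reg Z z, of x "1/2"] by simp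
  qed
  have ZK: "?Z \<subseteq> K"
    using mem_grid_cube_floor[OF h] by (fastforce simp: K_def I_def)
  have nz: "f z \<noteq> 0" if "z \<in> sphere c r" for z
    using Z that sphere_cball[of c r] by (fastforce simp: zero_set_def)
  obtain \<rho> where \<rho>: "continuous_on ?W \<rho>"
    "\<And>x. x \<in> cball c r \<Longrightarrow> \<bar>f x\<bar> \<le> 1/2 * delta c r f \<Longrightarrow> \<rho> x \<in> cball c r \<and> f (\<rho> x) = 0"
    "\<And>x. x \<in> cball c r \<Longrightarrow> f x = 0 \<Longrightarrow> \<rho> x = x"
  proof (rule retraction_onto_zero_set[of "cball c r" f "disk_gradient c r f" "1/2 * delta c r f"])
    show "?W \<subseteq> interior (cball c r)"
    proof
      fix x assume x: "x \<in> ?W"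
      then have "x \<notin> sphere c r" using delta_le_on_sphere[OF r C1 nz, of x] d by auto
      then show "x \<in> interior (cball c r)" using x by (simp add: less_le)
    qed
    fix x assume x: "x \<in> cball c r" "\<bar>f x\<bar> \<le> 1/2 * delta c r f"
    show "disk_gradient c r f x \<noteq> 0"
    proof
      assume "disk_gradient c r f x = 0"
      then have "delta c r f \<le> \<bar>f x\<bar>" using delta_le(1)[OF r C1 x(1)] by simp
      then show False using x(2) d by simp
    qed
  qed (use C1_has_derivative[OF r C1] C1_continuous[OF r C1] d in auto)
  have "total_betti ?Z \<le> total_betti K"
  proof (rule total_betti_retract[OF ZK])
    show "continuous_on K \<rho>" by (rule continuous_on_subset[OF \<rho>(1) KW])
    show "\<rho> ` K \<subseteq> ?Z" using \<rho>(2) KW by (auto simp: zero_set_def)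
    show "\<rho> x = x" if "x \<in> ?Z" for x using \<rho>(3) that by (auto simp: zero_set_def)
  qed
  also have "\<dots> \<le> enat (card I * 2 ^ 3 ^ ?n)"
    unfolding K_def by (rule total_betti_Union_grid_cubes[OF finite_subset[OF IA finA] h])
  also have "\<dots> \<le> enat (card A * 2 ^ 3 ^ ?n)" using card_mono[OF finA IA] by simp
  finally have "ereal_of_enat (total_betti ?Z) \<le> ereal_of_enat (enat (card A * 2 ^ 3 ^ ?n))"
    by (simp only: ereal_of_enat_le_iff)
  also have "\<dots> = ereal (real (card A) * 2 ^ 3 ^ ?n)" by simp
  also have "\<dots> \<le> ereal ((8 * r * ?n + 3) ^ ?n * \<kappa> ^ ?n * 2 ^ 3 ^ ?n)"
    using cardA by (simp add: mult_right_mono)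
  finally show ?thesis by (simp add: \<kappa>_def mult_ac)
qed

section \<open>Many bumps\<close>

text \<open>The square makes the truncation at \<open>s = 1\<close> continuously differentiable. The
  argument will be a squared distance, so there is no singularity at the centre of a bump
  either.\<close>

definition profile :: "real \<Rightarrow> real" where
  "profile s = (max 0 (1 - s))\<^sup>2"

text \<open>A remainder bound \<open>h\<^sup>2\<close> for the squared positive part, checked for
  all signs before and after the increment, treats the kink at \<open>s = 1\<close> like every other
  point.\<close>

lemma DERIV_profile: "(profile has_real_derivative - 2 * max 0 (1 - s)) (at s)"
proof -
  have bound: "\<bar>(max 0 (a - h))\<^sup>2 - (max 0 a)\<^sup>2 + 2 * max 0 a * h\<bar> \<le> h\<^sup>2" for a h :: real
  proof -
    consider "a \<ge> 0" "a - h \<ge> 0" | "a < 0" "a - h < 0" | "a < 0" "a - h \<ge> 0" | "a \<ge> 0" "a - h < 0"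
      by linarith
    then show ?thesis
    proof cases
      case 1
      then show ?thesis by (simp add: power2_eq_square algebra_simps)
    next
      case 2
      then show ?thesis by simp
    next
      case 3
      then have "\<bar>a - h\<bar> \<le> \<bar>h\<bar>" by linarith
      then have "(a - h)\<^sup>2 \<le> h\<^sup>2" by (rule abs_le_square_iff[THEN iffD1])
      then show ?thesis using 3 by simp
    next
      case 4
      then have "0 \<le> a * (2 * h - a)" "0 \<le> (h - a)\<^sup>2" by auto
      then show ?thesis using 4 by (simp add: power2_eq_square algebra_simps abs_le_iff)
    qed
  qed
  have "(\<lambda>h. (profile (s + h) - profile s) / h - (- 2 * max 0 (1 - s))) \<midarrow>0\<rightarrow> 0"
  proof (rule Lim_null_comparison)
    show "\<forall>\<^sub>F h in at 0. norm ((profile (s + h) - profile s) / h - (- 2 * max 0 (1 - s))) \<le> \<bar>h\<bar>"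
      unfolding eventually_at_filter
    proof (intro always_eventually allI impI)
      fix h :: real assume h: "h \<noteq> 0"
      have "(profile (s + h) - profile s) / h - (- 2 * max 0 (1 - s))
          = ((max 0 ((1 - s) - h))\<^sup>2 - (max 0 (1 - s))\<^sup>2 + 2 * max 0 (1 - s) * h) / h"
        using h by (simp add: profile_def field_simps)
      also have "\<bar>\<dots>\<bar> \<le> h\<^sup>2 / \<bar>h\<bar>"
        unfolding abs_divide by (intro divide_right_mono bound) simp
      also have "\<dots> = \<bar>h\<bar>" using h by (simp add: power2_eq_square abs_mult_self_eq divide_simps)
      finally show "norm ((profile (s + h) - profile s) / h - (- 2 * max 0 (1 - s))) \<le> \<bar>h\<bar>" by simp
    qed
    show "(\<lambda>h::real. \<bar>h\<bar>) \<midarrow>0\<rightarrow> 0" by (auto intro!: tendsto_eq_intros)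
  qed
  then have "(\<lambda>h. (profile (s + h) - profile s) / h) \<midarrow>0\<rightarrow> - 2 * max 0 (1 - s)"
    by (rule LIM_zero_cancel)
  then show ?thesis by (simp only: DERIV_def)
qed

section \<open>A function with a bump at every node of a lattice inside the disk\<close>

context
  fixes c :: "real^'n" and r :: real and m :: nat
  assumes r: "r > 0"
begin

text \<open>The factor \<open>CARD('n)\<close> comes from bounding the Euclidean norm by the sum of
  the coordinates; it keeps every node at distance at least \<open>mesh\<close> from the boundary
  sphere.\<close>

definition mesh :: real where
  "mesh = r / (CARD('n) * (real m + 1))"

definition nodes :: "('n \<Rightarrow> nat) set" where
  "nodes = PiE UNIV (\<lambda>_. {0..m})"

definition node :: "('n \<Rightarrow> nat) \<Rightarrow> real^'n" where
  "node k = c + mesh *\<^sub>R (\<chi> i. real (k i))"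

text \<open>The squared distance in units of \<open>mesh / 2\<close>: each bump is supported in the
  ball of that radius, and these balls are disjoint.\<close>

definition sqdist :: "('n \<Rightarrow> nat) \<Rightarrow> real^'n \<Rightarrow> real" where
  "sqdist k x = 4 / mesh\<^sup>2 * ((x - node k) \<bullet> (x - node k))"

definition bumps :: "real^'n \<Rightarrow> real" where
  "bumps x = mesh * ((\<Sum>k\<in>nodes. profile (sqdist k x)) - 1 / 2)"

text \<open>The gradient of \<open>bumps\<close> in closed form. The factor
  \<open>- 16 / mesh\<close> is the product of the height \<open>mesh\<close>,
  \<open>8 / mesh\<^sup>2\<close> from \<open>sqdist\<close> and \<open>- 2\<close> from
  \<open>profile\<close>.\<close>

definition bumps_grad :: "real^'n \<Rightarrow> real^'n" where
  "bumps_grad x = (\<Sum>k\<in>nodes. (- 16 / mesh * max 0 (1 - sqdist k x)) *\<^sub>R (x - node k))"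

lemma mesh: "mesh > 0" "mesh \<le> r" "mesh * CARD('n) * (real m + 1) = r"
proof -
  have n: "real CARD('n) \<ge> 1" by (simp add: Suc_le_eq)
  then have "real CARD('n) * (real m + 1) \<ge> 1 * 1" by (intro mult_mono) auto
  then have 1: "real CARD('n) * (real m + 1) \<ge> 1" by simp
  then show "mesh > 0" unfolding mesh_def using r by (intro divide_pos_pos) linarith+
  have "r * 1 \<le> r * (real CARD('n) * (real m + 1))" using r 1 by (intro mult_left_mono) auto
  then show "mesh \<le> r" unfolding mesh_def using 1 by (simp add: divide_le_eq)
  show "mesh * CARD('n) * (real m + 1) = r" unfolding mesh_def using 1 by (simp add: mult.assoc)
qed

lemma nodes: "finite nodes" "card nodes = (m + 1) ^ CARD('n)"
  by (auto simp: nodes_def card_PiE intro!: finite_PiE)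

lemma bumps_has_derivative: "(bumps has_derivative (\<lambda>h. bumps_grad x \<bullet> h)) (at x within S)"
proof -
  have s: "(sqdist k has_derivative (\<lambda>h. 8 / mesh\<^sup>2 * ((x - node k) \<bullet> h))) (at x within S)" for k
  proof -
    have "((\<lambda>x. (x - node k) \<bullet> (x - node k)) has_derivative (\<lambda>h. 2 * ((x - node k) \<bullet> h))) (at x within S)"
      by (auto intro!: derivative_eq_intros simp: inner_commute)
    from has_derivative_mult_right[OF this, of "4 / mesh\<^sup>2"] show ?thesis
      unfolding sqdist_def by simp
  qed
  have "((\<lambda>x. profile (sqdist k x)) has_derivative
      (\<lambda>h. 8 / mesh\<^sup>2 * ((x - node k) \<bullet> h) * (- 2 * max 0 (1 - sqdist k x)))) (at x within S)" for k
    by (rule DERIV_compose_FDERIV[OF DERIV_profile s])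
  then have "(bumps has_derivative (\<lambda>h. mesh * (\<Sum>k\<in>nodes.
      8 / mesh\<^sup>2 * ((x - node k) \<bullet> h) * (- 2 * max 0 (1 - sqdist k x))))) (at x within S)"
    unfolding bumps_def by (auto intro!: derivative_eq_intros)
  moreover have "mesh * (\<Sum>k\<in>nodes. 8 / mesh\<^sup>2 * ((x - node k) \<bullet> h) * (- 2 * max 0 (1 - sqdist k x)))
      = bumps_grad x \<bullet> h" for h
    unfolding bumps_grad_def inner_sum_left sum_distrib_left inner_scaleR_left
    using mesh(1) by (intro sum.cong refl) (simp add: power2_eq_square mult_ac)
  ultimately show ?thesis by simp
qed

lemma disk_gradient_bumps: "x \<in> cball c r \<Longrightarrow> disk_gradient c r bumps x = bumps_grad x"
  by (intro disk_gradient_eqI r bumps_has_derivative)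

lemma C1_on_disk_bumps: "C1_on_disk c r bumps"
proof -
  have "continuous_on (cball c r) bumps_grad"
    unfolding bumps_grad_def sqdist_def by (intro continuous_intros)
  then have "continuous_on (cball c r) (disk_gradient c r bumps)"
    by (rule continuous_on_eq) (simp add: disk_gradient_bumps)
  then show ?thesis
    using bumps_has_derivative by (auto simp: C1_on_disk_def differentiable_on_def differentiable_def)
qed

lemma node_distance:
  assumes "k \<noteq> l"
  shows "mesh \<le> norm (node k - node l)"
proof -
  obtain i where i: "k i \<noteq> l i" using assms by blast
  have "mesh * 1 \<le> mesh * \<bar>real (k i) - real (l i)\<bar>" using mesh(1) i by (intro mult_left_mono) auto
  also have "\<dots> = \<bar>(node k - node l) $ i\<bar>"
    using mesh(1) by (simp add: node_def abs_mult flip: right_diff_distrib)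
  also have "\<dots> \<le> norm (node k - node l)" by (rule component_le_norm_cart)
  finally show ?thesis by simp
qed

lemma sqdist_eq: "sqdist k x = (2 * norm (x - node k) / mesh)\<^sup>2"
  by (simp add: sqdist_def power2_norm_eq_inner[symmetric] power_divide power_mult_distrib)

lemma sqdist_ge_1: "mesh / 2 \<le> norm (x - node k) \<Longrightarrow> 1 \<le> sqdist k x"
  using mesh(1) unfolding sqdist_eq by (intro one_le_power) (simp add: field_simps)

lemma bumps_far:
  assumes "\<And>k. k \<in> nodes \<Longrightarrow> mesh / 2 \<le> norm (x - node k)"
  shows "bumps x = - mesh / 2"
proof -
  have "(\<Sum>k\<in>nodes. profile (sqdist k x)) = 0"
    using sqdist_ge_1[OF assms] by (intro sum.neutral) (auto simp: profile_def)
  then show ?thesis by (simp only: bumps_def) simp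
qed

text \<open>Nodes are at least \<open>mesh\<close> apart, so within \<open>mesh / 2\<close> of one
  node all other bumps vanish and the sums reduce to one term.\<close>

lemma bumps_near:
  assumes k: "k \<in> nodes" and x: "norm (x - node k) < mesh / 2"
  shows "bumps x = mesh * ((1 - sqdist k x)\<^sup>2 - 1 / 2)"
    and "bumps_grad x = (- 16 / mesh * (1 - sqdist k x)) *\<^sub>R (x - node k)"
    and "0 \<le> sqdist k x" "sqdist k x < 1"
proof -
  show s0: "0 \<le> sqdist k x" by (simp add: sqdist_eq)
  have "2 * norm (x - node k) / mesh < 1" using x mesh(1) by (simp add: field_simps)
  then show s1: "sqdist k x < 1"
    using mesh(1) unfolding sqdist_eq power_less_one_iff[OF divide_nonneg_pos[OF mult_nonneg_nonneg[OF zero_le_numeral norm_ge_zero] mesh(1)]] by simp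
  have far: "1 \<le> sqdist l x" if "l \<noteq> k" for l
  proof (rule sqdist_ge_1)
    have "mesh \<le> norm ((x - node l) - (x - node k))" using node_distance[of k l] that by simp
    also have "\<dots> \<le> norm (x - node l) + norm (x - node k)" by (rule norm_triangle_ineq4)
    finally show "mesh / 2 \<le> norm (x - node l)" using x by linarith
  qed
  have "(\<Sum>l\<in>nodes. profile (sqdist l x)) = (\<Sum>l\<in>{k}. profile (sqdist l x))"
    using nodes(1) k far by (intro sum.mono_neutral_right) (auto simp: profile_def)
  then show "bumps x = mesh * ((1 - sqdist k x)\<^sup>2 - 1 / 2)"
    using s1 by (simp add: bumps_def profile_def)
  have "bumps_grad x = (\<Sum>l\<in>{k}. (- 16 / mesh * max 0 (1 - sqdist l x)) *\<^sub>R (x - node l))"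
    unfolding bumps_grad_def using nodes(1) k far by (intro sum.mono_neutral_right) auto
  then show "bumps_grad x = (- 16 / mesh * (1 - sqdist k x)) *\<^sub>R (x - node k)"
    using s1 by simp
qed

lemma bumps_grad_far:
  assumes "\<And>k. k \<in> nodes \<Longrightarrow> mesh / 2 \<le> norm (x - node k)"
  shows "bumps_grad x = 0"
  unfolding bumps_grad_def using sqdist_ge_1[OF assms] by (intro sum.neutral) auto

lemma norm_bumps_grad_near:
  assumes k: "k \<in> nodes" and x: "norm (x - node k) < mesh / 2"
  shows "(norm (bumps_grad x))\<^sup>2 = 64 * (1 - sqdist k x)\<^sup>2 * sqdist k x"
proof -
  have "(norm (x - node k))\<^sup>2 = mesh\<^sup>2 / 4 * sqdist k x"
    using mesh(1) by (simp add: sqdist_eq power_divide power_mult_distrib)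
  moreover have "(norm (v *\<^sub>R y))\<^sup>2 = v\<^sup>2 * (norm y)\<^sup>2" for v and y :: "real^'n"
    by (simp add: power_mult_distrib)
  ultimately have "(norm (bumps_grad x))\<^sup>2 = (- 16 / mesh * (1 - sqdist k x))\<^sup>2 * (mesh\<^sup>2 / 4 * sqdist k x)"
    unfolding bumps_near(2)[OF k x] by (simp only:)
  also have "\<dots> = 64 * v\<^sup>2 * sqdist k x" if "v = 1 - sqdist k x" for v
    unfolding that[symmetric] using mesh(1) by (simp add: power_mult_distrib power_divide)
  finally show ?thesis by simp
qed

text \<open>The bound does not involve \<open>m\<close>: values are at most
  \<open>mesh \<le> r\<close>, and the squared gradient \<open>64 * (1 - s)\<^sup>2 * s\<close> is
  at most 64.\<close>

lemma bumps_upper: "sqrt ((bumps x)\<^sup>2 + (norm (bumps_grad x))\<^sup>2) \<le> r + 8"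
proof -
  have "\<bar>bumps x\<bar> \<le> r \<and> norm (bumps_grad x) \<le> 8"
  proof (cases "\<exists>k\<in>nodes. norm (x - node k) < mesh / 2")
    case True
    then obtain k where k: "k \<in> nodes" "norm (x - node k) < mesh / 2" by blast
    define s where "s = sqdist k x"
    have s: "0 \<le> s" "s < 1" using bumps_near(3,4)[OF k] by (auto simp: s_def)
    have q: "0 \<le> (1 - s)\<^sup>2" "(1 - s)\<^sup>2 \<le> 1" using s by (auto simp: power_le_one)
    have "\<bar>bumps x\<bar> = mesh * \<bar>(1 - s)\<^sup>2 - 1 / 2\<bar>"
      using bumps_near(1)[OF k] mesh(1) by (simp add: s_def abs_mult)
    also have "\<bar>(1 - s)\<^sup>2 - 1 / 2\<bar> \<le> 1" using q by linarith
    then have "mesh * \<bar>(1 - s)\<^sup>2 - 1 / 2\<bar> \<le> mesh * 1" using mesh(1) by (intro mult_left_mono) auto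
    finally have "\<bar>bumps x\<bar> \<le> r" using mesh(2) by simp
    moreover have "norm (bumps_grad x) \<le> 8"
    proof (rule power2_le_imp_le)
      have "(1 - s)\<^sup>2 * s \<le> 1 * 1" using q s by (intro mult_mono) auto
      then show "(norm (bumps_grad x))\<^sup>2 \<le> 8\<^sup>2" using norm_bumps_grad_near[OF k] by (simp add: s_def)
    qed simp
    ultimately show ?thesis by blast
  next
    case False
    then have far: "\<And>k. k \<in> nodes \<Longrightarrow> mesh / 2 \<le> norm (x - node k)" by (auto simp: not_less)
    show ?thesis using bumps_far[OF far] bumps_grad_far[OF far] mesh by simp
  qed
  then show ?thesis
    using sqrt_sum_squares_le_sum_abs[of "bumps x" "norm (bumps_grad x)"] by simp
qed

text \<open>Away from the level \<open>v\<^sup>2 = 1/2\<close> the value alone gives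
  \<open>mesh / 4\<close>. Close to it, \<open>v\<^sup>2 \<ge> 1/4\<close> and
  \<open>1 - v \<ge> 1/8\<close>, so the squared gradient is at least
  \<open>64 / 32 = 2\<close>.\<close>

lemma bumps_lower: "min (mesh / 4) 1 \<le> sqrt ((bumps x)\<^sup>2 + (norm (bumps_grad x))\<^sup>2)"
proof -
  have f: "\<bar>bumps x\<bar> \<le> sqrt ((bumps x)\<^sup>2 + (norm (bumps_grad x))\<^sup>2)"
    by (rule real_le_rsqrt) simp
  show ?thesis
  proof (cases "\<exists>k\<in>nodes. norm (x - node k) < mesh / 2")
    case True
    then obtain k where k: "k \<in> nodes" "norm (x - node k) < mesh / 2" by blast
    define v where "v = 1 - sqdist k x"
    have v: "0 < v" "v \<le> 1" using bumps_near(3,4)[OF k] by (auto simp: v_def)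
    show ?thesis
    proof (cases "\<bar>v\<^sup>2 - 1 / 2\<bar> \<ge> 1 / 4")
      case True
      have "\<bar>bumps x\<bar> = mesh * \<bar>v\<^sup>2 - 1 / 2\<bar>"
        using bumps_near(1)[OF k] mesh(1) by (simp add: v_def abs_mult)
      moreover have "mesh * (1 / 4) \<le> mesh * \<bar>v\<^sup>2 - 1 / 2\<bar>"
        using True mesh(1) by (intro mult_left_mono) auto
      ultimately show ?thesis using f by linarith
    next
      case False
      then have v2: "1 / 4 \<le> v\<^sup>2" "v\<^sup>2 \<le> 3 / 4" by (auto simp: abs_if split: if_splits)
      have "1 / 4 \<le> (1 - v) * (1 + v)" using v2 by (simp add: power2_eq_square algebra_simps)
      also have "\<dots> \<le> (1 - v) * 2" using v by (intro mult_left_mono) auto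
      finally have "1 / 8 \<le> 1 - v" by simp
      then have "1 / 4 * (1 / 8) \<le> v\<^sup>2 * (1 - v)" using v2 by (intro mult_mono) auto
      then have "1\<^sup>2 \<le> (norm (bumps_grad x))\<^sup>2"
        using norm_bumps_grad_near[OF k] by (simp add: v_def)
      then have "1 \<le> sqrt ((bumps x)\<^sup>2 + (norm (bumps_grad x))\<^sup>2)"
        by (intro real_le_rsqrt) (simp add: add_increasing)
      then show ?thesis by linarith
    qed
  next
    case False
    then have "bumps x = - mesh / 2" by (intro bumps_far) (auto simp: not_less)
    then show ?thesis using f mesh(1) by linarith
  qed
qed

lemma norm_node_le: "k \<in> nodes \<Longrightarrow> norm (node k - c) \<le> r - mesh"
proof -
  assume k: "k \<in> nodes"
  have "norm (\<chi> i. real (k i)) \<le> (\<Sum>i\<in>UNIV. \<bar>(\<chi> i. real (k i)) $ i\<bar>)" by (rule norm_le_l1_cart)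
  also have "\<dots> \<le> (\<Sum>i\<in>(UNIV::'n set). real m)"
    using k by (intro sum_mono) (auto simp: nodes_def PiE_UNIV_domain)
  finally have "norm (\<chi> i. real (k i)) \<le> CARD('n) * real m" by simp
  then have "norm (node k - c) \<le> mesh * (CARD('n) * real m)"
    using mesh(1) by (simp add: node_def mult_left_mono)
  also have "\<dots> = r - mesh * CARD('n)" using mesh(3) by (simp add: algebra_simps)
  also have "\<dots> \<le> r - mesh * 1" using mesh(1) by (intro diff_left_mono mult_left_mono) (auto simp: Suc_le_eq)
  finally show ?thesis by simp
qed

lemma bumps_on_sphere:
  assumes "x \<in> sphere c r"
  shows "bumps x = - mesh / 2"
proof (rule bumps_far)
  fix k assume "k \<in> nodes"
  from norm_node_le[OF this] have "norm (node k - c) \<le> r - mesh" .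
  moreover have "r \<le> norm (x - node k) + norm (node k - c)"
    using assms norm_triangle_ineq[of "x - node k" "node k - c"]
    by (simp add: dist_norm norm_minus_commute)
  ultimately show "mesh / 2 \<le> norm (x - node k)" using mesh(1) by linarith
qed

lemma zero_set_bumps: "zero_set c r bumps \<subseteq> ball c r"
proof
  fix x assume x: "x \<in> zero_set c r bumps"
  then have "x \<notin> sphere c r" using bumps_on_sphere[of x] mesh(1) by (auto simp: zero_set_def)
  then show "x \<in> ball c r" using x by (auto simp: zero_set_def)
qed

lemma regular_bumps: "regular c r bumps"
  unfolding regular_def
proof (intro conjI ballI)
  fix z assume z: "z \<in> zero_set c r bumps"
  then have "disk_gradient c r bumps z = bumps_grad z"
    by (intro disk_gradient_bumps) (auto simp: zero_set_def)
  then show "disk_gradient c r bumps z \<noteq> 0"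
    using z bumps_lower[of z] mesh(1) by (auto simp: zero_set_def)
next
  fix z assume "z \<in> zero_set c r bumps \<inter> sphere c r"
  then show "sphere_gradient c r bumps z \<noteq> 0" using zero_set_bumps by fastforce
qed

lemma C1_norm_bumps: "C1_norm c r bumps \<le> r + 8"
  unfolding C1_norm_def
  using r by (intro cSUP_least) (auto simp: disk_gradient_bumps bumps_upper)

text \<open>On the sphere the constant value \<open>- mesh / 2\<close> suffices, and the tangential
  gradient is simply discarded.\<close>

lemma delta_bumps: "min (mesh / 4) 1 \<le> delta c r bumps"
  unfolding delta_def
proof (intro min.boundedI)
  show "min (mesh / 4) 1 \<le> (INF z\<in>cball c r. sqrt ((bumps z)\<^sup>2 + (norm (disk_gradient c r bumps z))\<^sup>2))"
  proof (rule cINF_greatest)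
    fix z assume "z \<in> cball c r"
    then show "min (mesh / 4) 1 \<le> sqrt ((bumps z)\<^sup>2 + (norm (disk_gradient c r bumps z))\<^sup>2)"
      using bumps_lower[of z] by (simp only: disk_gradient_bumps)
  qed (use r in auto)
  show "min (mesh / 4) 1 \<le> (INF z\<in>sphere c r. sqrt ((bumps z)\<^sup>2 + (norm (sphere_gradient c r bumps z))\<^sup>2))"
  proof (rule cINF_greatest)
    fix z assume "z \<in> sphere c r"
    then have "\<bar>bumps z\<bar> = mesh / 2" using bumps_on_sphere mesh(1) by simp
    moreover have "\<bar>bumps z\<bar> \<le> sqrt ((bumps z)\<^sup>2 + (norm (sphere_gradient c r bumps z))\<^sup>2)"
      by (rule real_le_rsqrt) simp
    ultimately show "min (mesh / 4) 1 \<le> sqrt ((bumps z)\<^sup>2 + (norm (sphere_gradient c r bumps z))\<^sup>2)"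
      using mesh(1) by linarith
  qed (use r in auto)
qed

lemma kappa1_bumps: "0 \<le> kappa1 c r bumps"
  "kappa1 c r bumps \<le> 4 * (r + 8) * (r + 1) / r * CARD('n) * (real m + 1)"
proof -
  have d: "delta c r bumps > 0" using delta_bumps mesh(1) by linarith
  \<comment> \<open>A single lower bound for both entries of the minimum, linear in
    \<open>mesh\<close>; the second comparison uses \<open>mesh \<le> r\<close>.\<close>
  have "mesh / (4 * (r + 1)) \<le> mesh / 4" using r mesh(1) by (intro divide_left_mono) auto
  moreover have "mesh / (4 * (r + 1)) \<le> 1" using r mesh(2) by simp
  ultimately have dm: "mesh / (4 * (r + 1)) \<le> delta c r bumps"
    by (rule order_trans[OF min.boundedI delta_bumps])
  have N: "0 \<le> C1_norm c r bumps"
  proof -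
    have "sqrt ((bumps c)\<^sup>2 + (norm (disk_gradient c r bumps c))\<^sup>2) \<le> C1_norm c r bumps"
      unfolding C1_norm_def
      using r by (intro cSUP_upper bdd_aboveI2[of _ _ "r + 8"]) (auto simp: disk_gradient_bumps bumps_upper)
    then show ?thesis by (rule order_trans[rotated]) simp
  qed
  then show "0 \<le> kappa1 c r bumps" using d by (simp add: kappa1_def)
  have "kappa1 c r bumps \<le> (r + 8) / (mesh / (4 * (r + 1)))"
    unfolding kappa1_def using N C1_norm_bumps dm mesh(1) r by (intro frac_le) auto
  also have "\<dots> = 4 * (r + 8) * (r + 1) / r * (r / mesh)" using r mesh(1) by (simp add: field_simps)
  also have "r / mesh = CARD('n) * (real m + 1)"
    using mesh(1,3) by (simp add: field_simps)
  finally show "kappa1 c r bumps \<le> 4 * (r + 8) * (r + 1) / r * CARD('n) * (real m + 1)"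
    by (simp only: mult.assoc)
qed

lemma total_betti_bumps: "enat ((m + 1) ^ CARD('n)) \<le> total_betti (zero_set c r bumps)"
proof -
  have "enat (card nodes) \<le> total_betti (zero_set c r bumps)"
  proof (rule card_le_total_betti[OF nodes(1), of "\<lambda>k. ball (node k) (mesh / 2)"])
    show "disjoint_family_on (\<lambda>k. ball (node k) (mesh / 2)) nodes"
      unfolding disjoint_family_on_def
    proof (intro ballI impI)
      fix k l :: "'n \<Rightarrow> nat" assume "k \<noteq> l"
      then have "mesh \<le> dist (node k) (node l)" using node_distance by (simp add: dist_norm)
      then show "ball (node k) (mesh / 2) \<inter> ball (node l) (mesh / 2) = {}"
        by (intro disjoint_ballI) simp
    qed
    show "zero_set c r bumps \<subseteq> (\<Union>k\<in>nodes. ball (node k) (mesh / 2))"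
    proof
      fix x assume x: "x \<in> zero_set c r bumps"
      have "\<exists>k\<in>nodes. norm (x - node k) < mesh / 2"
      proof (rule ccontr)
        assume "\<not> ?thesis"
        then have "bumps x = - mesh / 2" by (intro bumps_far) (auto simp: not_less)
        then show False using x mesh(1) by (simp add: zero_set_def)
      qed
      then show "x \<in> (\<Union>k\<in>nodes. ball (node k) (mesh / 2))"
        by (auto simp: dist_norm norm_minus_commute)
    qed
    show "open (ball (node k) (mesh / 2))" if "k \<in> nodes" for k by simp
    fix k assume k: "k \<in> nodes"
    \<comment> \<open>The root of \<open>(1 - s)\<^sup>2 = 1/2\<close> in the unit interval, so that
      \<open>bumps\<close> vanishes where \<open>sqdist k x = s\<close>.\<close>
    define s where "s = 1 - 1 / sqrt 2"
    have s: "0 \<le> s" "s < 1" by (auto simp: s_def)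
    obtain e :: "real^'n" where e: "norm e = 1" using vector_choose_size[of 1] by auto
    define x where "x = node k + (mesh / 2 * sqrt s) *\<^sub>R e"
    have nx: "norm (x - node k) = mesh / 2 * sqrt s" using e mesh(1) s by (simp add: x_def)
    moreover have "mesh / 2 * sqrt s < mesh / 2 * 1"
      using mesh(1) s by (intro mult_strict_left_mono) auto
    ultimately have lt: "norm (x - node k) < mesh / 2" by simp
    have "sqdist k x = s" unfolding sqdist_eq nx using mesh(1) s by simp
    then have "bumps x = 0"
      using bumps_near(1)[OF k lt] by (simp add: s_def power_divide)
    moreover have "x \<in> cball c r"
      using norm_triangle_ineq[of "x - node k" "node k - c"] lt norm_node_le[OF k] mesh(1)
      by (simp add: dist_norm norm_minus_commute)
    ultimately have "x \<in> zero_set c r bumps \<inter> ball (node k) (mesh / 2)"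
      using lt by (simp add: zero_set_def dist_norm norm_minus_commute)
    then show "zero_set c r bumps \<inter> ball (node k) (mesh / 2) \<noteq> {}" by blast
  qed
  then show ?thesis by (simp add: nodes(2))
qed

end

theorem theorem8:
  fixes c :: "real^'n" and r :: real
  assumes "r > 0"
  shows
    "(\<exists>c4 > 0. \<forall>f :: real^'n \<Rightarrow> real.
        C1_on_disk c r f \<and> regular c r f \<and> zero_set c r f \<subseteq> ball c r \<longrightarrow>
        ereal_of_enat (total_betti (zero_set c r f)) \<le> ereal (c4 * kappa1 c r f ^ CARD('n))) \<and>
     (\<exists>f :: nat \<Rightarrow> real^'n \<Rightarrow> real.
        (\<forall>m. C1_on_disk c r (f m)) \<and>
        (\<exists>B. \<forall>m. C1_norm c r (f m) \<le> B) \<and>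
        filterlim (\<lambda>m. kappa1 c r (f m)) at_top sequentially \<and>
        (\<exists>c5 > 0. \<forall>m.
           zero_set c r (f m) \<subseteq> ball c r \<and> regular c r (f m) \<and>
           ereal_of_enat (total_betti (zero_set c r (f m)))
             \<ge> ereal (c5 * kappa1 c r (f m) ^ CARD('n))))"
proof -
  let ?n = "CARD('n)" and ?f = "bumps c r"
  define A where "A = (2::real) ^ 3 ^ ?n * (8 * r * ?n + 3) ^ ?n"
  have upper: "ereal_of_enat (total_betti (zero_set c r f)) \<le> ereal (A * kappa1 c r f ^ ?n)"
    if "C1_on_disk c r f" "regular c r f" "zero_set c r f \<subseteq> ball c r" for f
    unfolding A_def by (rule total_betti_zero_set_le[OF assms that])
  have "8 * r * ?n + 3 > 0" using assms by (simp add: add_nonneg_pos)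
  then have A: "A > 0" unfolding A_def by simp
  have many: "ereal ((real m + 1) ^ ?n) \<le> ereal_of_enat (total_betti (zero_set c r (?f m)))" for m
  proof -
    have "ereal_of_enat (enat ((m + 1) ^ ?n)) \<le> ereal_of_enat (total_betti (zero_set c r (?f m)))"
      unfolding ereal_of_enat_le_iff by (rule total_betti_bumps[OF assms])
    then show ?thesis by (simp add: add.commute)
  qed
  define B where "B = 4 * (r + 8) * (r + 1) / r * ?n"
  have B: "B > 0" using assms by (simp add: B_def)
  have \<kappa>: "0 \<le> kappa1 c r (?f m)" "kappa1 c r (?f m) \<le> B * (real m + 1)" for m
    using kappa1_bumps[OF assms] by (simp_all add: B_def)
  have lower: "ereal (1 / B ^ ?n * kappa1 c r (?f m) ^ ?n) \<le> ereal_of_enat (total_betti (zero_set c r (?f m)))" for m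
  proof -
    have "kappa1 c r (?f m) ^ ?n \<le> (B * (real m + 1)) ^ ?n" using \<kappa> by (intro power_mono)
    then have "kappa1 c r (?f m) ^ ?n \<le> B ^ ?n * (real m + 1) ^ ?n" by (simp only: power_mult_distrib)
    then have "1 / B ^ ?n * kappa1 c r (?f m) ^ ?n \<le> (real m + 1) ^ ?n"
      using B by (simp add: divide_le_eq mult.commute)
    then show ?thesis using many[of m] by (meson ereal_less_eq(3) order_trans)
  qed
  \<comment> \<open>The upper bound of the first part forces the condition numbers of the example to diverge.\<close>
  have ge: "(real m + 1) / max A 1 \<le> kappa1 c r (?f m)" for m
  proof -
    have "ereal ((real m + 1) ^ ?n) \<le> ereal (A * kappa1 c r (?f m) ^ ?n)"
      using many[of m] upper[of "?f m"] C1_on_disk_bumps[OF assms] regular_bumps[OF assms]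
        zero_set_bumps[OF assms] by (meson order_trans)
    then have "(real m + 1) ^ ?n \<le> A * kappa1 c r (?f m) ^ ?n" by simp
    \<comment> \<open>Replacing \<open>A\<close> by an \<open>n\<close>-th power puts the constant
      under the power, so that \<open>n\<close>-th roots can be taken on both sides.\<close>
    also have "A \<le> max A 1 ^ ?n" using self_le_power[of "max A 1" ?n] by simp
    then have "A * kappa1 c r (?f m) ^ ?n \<le> (max A 1 * kappa1 c r (?f m)) ^ ?n"
      unfolding power_mult_distrib using \<kappa>(1) by (intro mult_right_mono) auto
    finally have "real m + 1 \<le> max A 1 * kappa1 c r (?f m)"
      using \<kappa>(1)[of m] by (subst (asm) power_mono_iff) (auto simp: add_nonneg_nonneg)
    moreover have "max A 1 > 0" by simp
    ultimately show ?thesis by (simp only: pos_divide_le_eq mult.commute)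
  qed
  have lin: "filterlim (\<lambda>m. (real m + 1) / max A 1) at_top sequentially"
  proof -
    have "filterlim (\<lambda>m. 1 / max A 1 * (1 + real m)) at_top sequentially"
      by (intro filterlim_tendsto_pos_mult_at_top[OF tendsto_const]
          filterlim_tendsto_add_at_top[OF tendsto_const] filterlim_real_sequentially) simp
    then show ?thesis by (simp add: add.commute)
  qed
  show ?thesis
  proof (rule conjI)
    show "\<exists>c4 > 0. \<forall>f :: real^'n \<Rightarrow> real.
        C1_on_disk c r f \<and> regular c r f \<and> zero_set c r f \<subseteq> ball c r \<longrightarrow>
        ereal_of_enat (total_betti (zero_set c r f)) \<le> ereal (c4 * kappa1 c r f ^ ?n)"
      using A upper by blast
    have "filterlim (\<lambda>m. kappa1 c r (?f m)) at_top sequentially"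
      by (rule filterlim_at_top_mono[OF lin always_eventually]) (use ge in blast)
    moreover have "\<exists>B. \<forall>m. C1_norm c r (?f m) \<le> B" using C1_norm_bumps[OF assms] by blast
    moreover have "\<exists>c5 > 0. \<forall>m. zero_set c r (?f m) \<subseteq> ball c r \<and> regular c r (?f m) \<and>
        ereal_of_enat (total_betti (zero_set c r (?f m))) \<ge> ereal (c5 * kappa1 c r (?f m) ^ ?n)"
      using B lower regular_bumps[OF assms] zero_set_bumps[OF assms]
      by (intro exI[of _ "1 / B ^ ?n"] conjI allI) simp_all
    ultimately show "\<exists>f :: nat \<Rightarrow> real^'n \<Rightarrow> real.
        (\<forall>m. C1_on_disk c r (f m)) \<and>
        (\<exists>B. \<forall>m. C1_norm c r (f m) \<le> B) \<and>
        filterlim (\<lambda>m. kappa1 c r (f m)) at_top sequentially \<and>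
        (\<exists>c5 > 0. \<forall>m.
           zero_set c r (f m) \<subseteq> ball c r \<and> regular c r (f m) \<and>
           ereal_of_enat (total_betti (zero_set c r (f m)))
             \<ge> ereal (c5 * kappa1 c r (f m) ^ ?n))"
      using C1_on_disk_bumps[OF assms] by (intro exI[of _ ?f] conjI allI) assumption+
  qed
qed

end
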